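(* Let $m\ge1$ be an integer, let $H_m$ be the Heisenberg group with homogeneous dimension $Q=2m+2$ and sub-Laplacian $D$, let $k>Q/4$ be a natural number, let $j\in\mathbb{Z}$, and let $\{s_\gamma\}\in \ell_2$ be a sequence indexed by the points $x_\gamma$ of $\Gamma_j$. Let $s_{k,j}\in S^{2k}(H_m)$ be the function that satisfies $s_{k,j}(x_\gamma)=s_\gamma$ for all $x_\gamma\in\Gamma_j$ and minimizes the functional $u\mapsto\|D^ku\|$ among all $u\in S^{2k}(H_m)$ with these values on $\Gamma_j$. Then there is a sequence $\{\alpha_\gamma\}\in \ell_2$ such that, in the sense of distributions, $$D^{2k}s_{k,j}=\sum_{x_\gamma\in\Gamma_j}\alpha_\gamma\,\delta(x_\gamma),$$ where $\delta(x)$ is the Dirac measure at $x$.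
   Context: $H_m$ is the Lie group with underlying manifold $\mathbb{R}\times\mathbb{C}^m$ and composition $(t,z)(t',z')=(t+t'+2\,\mathrm{Im}(z\cdot\overline{z'}),\,z+z')$, where $z\cdot\overline{z'}=\sum_k z_k\overline{z'_k}$. Dilations are $\delta_s(t,z)=(s^2t,sz)$, and $Q=2m+2$. Writing $z_k=x_k+iy_k$, set $X_k=\partial_{x_k}+2y_k\partial_t$ and $X_{m+k}=\partial_{y_k}-2x_k\partial_t$ for $1\le k\le m$, and $T=\partial_t$; these form a basis of the left-invariant vector fields. The sub-Laplacian $D=-X_1^2-\dots-X_{2m}^2$ is a self-adjoint nonnegative operator in $L^2(H_m)$ (with respect to Haar measure, i.e. Lebesgue measure); $\|\cdot\|$ is the $L^2(H_m)$ norm. For $\sigma\ge0$, $S^\sigma(H_m)$ is the Sobolev space with norm $\|(I+D)^{\sigma/2}f\|$, equivalent to $\|f\|+\|D^{\sigma/2}f\|$; for $\sigma>Q/2$ its elements are continuous, so point values make sense. For $j\in\mathbb{Z}$, $\Gamma_j$ is the discrete subgroup of all elements $\exp(2^{2j}n_0T+2^jn_1X_1+\dots+2^jn_{2m}X_{2m})$ with $n_0,\dots,n_{2m}\in\mathbb{Z}$. For $k>Q/4$ and data in $\ell_2$ the minimizer $s_{k,j}$ exists and is unique. *)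

theory Defs
  imports "HOL-Analysis.Analysis"
begin

section \<open>The Heisenberg group\<close>

text \<open>
  The index type \<open>'m\<close> plays the role of \<open>{1..m}\<close>. The additive and metric structure inherited from
  the product type is that of the underlying manifold; \<open>0 = (0, 0)\<close> is also the group identity,
  and \<open>lborel\<close> is a Haar measure.
\<close>

type_synonym 'm heis = "real \<times> (complex ^ 'm)"

definition heis_mult :: "'m::finite heis \<Rightarrow> 'm heis \<Rightarrow> 'm heis" where
  "heis_mult p q =
     (fst p + fst q + 2 * Im (\<Sum>k\<in>UNIV. snd p $ k * cnj (snd q $ k)), snd p + snd q)"

definition hom_dim :: "'m::finite itself \<Rightarrow> nat" where
  "hom_dim _ = 2 * CARD('m) + 2"

text \<open>
  A vector field is given by the tangent vector at each point. \<open>Y_field k\<close> is the field \<open>X_(m+k)\<close>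
  in the usual numbering.
\<close>

definition T_field :: "'m::finite heis \<Rightarrow> 'm heis" where
  "T_field p = (1, 0)"

definition X_field :: "'m::finite \<Rightarrow> 'm heis \<Rightarrow> 'm heis" where
  "X_field k p = (2 * Im (snd p $ k), axis k 1)"

definition Y_field :: "'m::finite \<Rightarrow> 'm heis \<Rightarrow> 'm heis" where
  "Y_field k p = (- 2 * Re (snd p $ k), axis k \<i>)"

text \<open>
  The exponential of a left-invariant field \<open>V\<close>: the value at time 1 of the one-parameter subgroup
  with initial velocity \<open>V 0\<close>.
\<close>

definition one_param_subgroup :: "(real \<Rightarrow> 'm::finite heis) \<Rightarrow> bool" where
  "one_param_subgroup c \<longleftrightarrow> (\<forall>s t. c (s + t) = heis_mult (c s) (c t))"

definition heis_exp :: "('m::finite heis \<Rightarrow> 'm heis) \<Rightarrow> 'm heis" where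
  "heis_exp V = (THE c. one_param_subgroup c \<and> (c has_vector_derivative V 0) (at 0)) 1"

definition heis_lattice :: "int \<Rightarrow> 'm::finite heis set" where
  "heis_lattice j =
     {heis_exp (\<lambda>p. (2 powi (2 * j) * of_int n0) *\<^sub>R T_field p
          + (\<Sum>k\<in>UNIV. (2 powi j * of_int (n k)) *\<^sub>R X_field k p)
          + (\<Sum>k\<in>UNIV. (2 powi j * of_int (n' k)) *\<^sub>R Y_field k p))
      | (n0 :: int) (n :: 'm \<Rightarrow> int) (n' :: 'm \<Rightarrow> int). True}"

lemma additive_deriv_linear:
  fixes f :: "real \<Rightarrow> 'a::real_normed_vector"
  assumes add: "\<And>s t. f (s + t) = f s + f t" and d: "(f has_vector_derivative v) (at 0)"
  shows "f s = s *\<^sub>R v"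
proof -
  have f0: "f 0 = 0" using add[of 0 0] by simp
  have D: "(f has_vector_derivative v) (at x)" for x
  proof -
    have "((\<lambda>u. u - x) has_vector_derivative 1) (at x)"
      by (auto intro!: derivative_eq_intros)
    then have "((f \<circ> (\<lambda>u. u - x)) has_vector_derivative (1 *\<^sub>R v)) (at x)"
      by (rule vector_diff_chain_at) (simp add: d)
    then have "((\<lambda>u. f x + f (u - x)) has_vector_derivative v) (at x)"
      by (auto intro!: derivative_eq_intros simp: o_def)
    moreover have "f x + f (u - x) = f u" for u using add[of x "u - x"] by simp
    ultimately show ?thesis by simp
  qed
  have Z: "((\<lambda>u. f u - u *\<^sub>R v) has_vector_derivative 0) (at x within UNIV)" for x
    using has_vector_derivative_diff[OF D[of x]
        has_vector_derivative_scaleR[OF DERIV_ident has_vector_derivative_const], of v] by simp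
  obtain c where "\<And>x. x \<in> UNIV \<Longrightarrow> f x - x *\<^sub>R v = c"
    by (rule has_vector_derivative_zero_constant[OF convex_UNIV Z]) blast
  from this[of 0] this[of s] f0 show ?thesis by simp
qed

text \<open>In these coordinates the exponential map is the identity.\<close>

lemma heis_exp_eq: "heis_exp V = V 0"
proof -
  have tw: "Im (\<Sum>k\<in>UNIV. (s *\<^sub>R w) $ k * cnj ((t *\<^sub>R w) $ k)) = 0"
    for s t :: real and w :: "complex ^ 'a"
    by (simp add: sum.neutral mult.commute)
  have "(THE c. one_param_subgroup c \<and> (c has_vector_derivative V 0) (at 0)) = (\<lambda>s. s *\<^sub>R V 0)"
  proof (rule the_equality, intro conjI)
    show "one_param_subgroup (\<lambda>s. s *\<^sub>R V 0)"
      unfolding one_param_subgroup_def heis_mult_def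
      by (auto simp: prod_eq_iff scaleR_left_distrib tw simp del: vector_scaleR_component Im_sum)
    show "((\<lambda>s. s *\<^sub>R V 0) has_vector_derivative V 0) (at 0)"
      by (auto intro!: derivative_eq_intros)
  next
    fix c assume c: "one_param_subgroup c \<and> (c has_vector_derivative V 0) (at 0)"
    then have h: "\<And>s t. c (s + t) = heis_mult (c s) (c t)"
      and d: "(c has_vector_derivative V 0) (at 0)"
      by (auto simp: one_param_subgroup_def)
    have d1: "((\<lambda>s. fst (c s)) has_vector_derivative fst (V 0)) (at 0)"
      and d2: "((\<lambda>s. snd (c s)) has_vector_derivative snd (V 0)) (at 0)"
      using bounded_linear.has_vector_derivative[OF bounded_linear_fst d]
        bounded_linear.has_vector_derivative[OF bounded_linear_snd d] by auto
    have s: "snd (c s) = s *\<^sub>R snd (V 0)" for s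
      by (rule additive_deriv_linear[OF _ d2]) (simp add: h heis_mult_def)
    have "fst (c s) = s *\<^sub>R fst (V 0)" for s
    proof (rule additive_deriv_linear[OF _ d1])
      show "fst (c (s + t)) = fst (c s) + fst (c t)" for s t
        by (simp add: h heis_mult_def s tw del: vector_scaleR_component Im_sum)
    qed
    with s show "c = (\<lambda>s. s *\<^sub>R V 0)" by (auto simp: prod_eq_iff)
  qed
  then show ?thesis by (simp add: heis_exp_def)
qed

lemma sum_axis: "(\<Sum>k\<in>UNIV. r k *\<^sub>R axis k z) = (\<chi> k. r k *\<^sub>R (z :: complex))"
proof -
  have "(\<Sum>k\<in>UNIV. r k *\<^sub>R axis k z $ i) = r i *\<^sub>R z" for i
  proof -
    have "(\<Sum>k\<in>UNIV. r k *\<^sub>R axis k z $ i) = (\<Sum>k\<in>UNIV. if k = i then r k *\<^sub>R z else 0)"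
      by (rule sum.cong) (auto simp: axis_def)
    then show ?thesis by simp
  qed
  then show ?thesis by (simp add: vec_eq_iff)
qed

lemma heis_lattice_eq:
  "(heis_lattice j :: 'm::finite heis set) =
     {(2 powi (2 * j) * of_int n0, \<chi> k. 2 powi j * Complex (of_int (n k)) (of_int (n' k)))
      | (n0 :: int) (n :: 'm \<Rightarrow> int) (n' :: 'm \<Rightarrow> int). True}"
proof -
  have C: "(c * a) *\<^sub>R 1 + (c * b) *\<^sub>R \<i> = of_real c * Complex a b" for a b c
    by (simp add: complex_eq_iff)
  have *: "(2 powi (2 * j) * of_int n0) *\<^sub>R T_field 0
          + (\<Sum>k\<in>UNIV. (2 powi j * of_int (n k)) *\<^sub>R X_field k 0)
          + (\<Sum>k\<in>UNIV. (2 powi j * of_int (n' k)) *\<^sub>R Y_field k 0)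
        = ((2 powi (2 * j) * of_int n0, \<chi> k. 2 powi j * Complex (of_int (n k)) (of_int (n' k)))
           :: 'm heis)" (is "?L = ?R") for n0 n n'
  proof (rule prod_eqI)
    show "fst ?L = fst ?R"
      by (simp add: T_field_def X_field_def Y_field_def fst_sum)
    have "snd ?L = (\<chi> k. (2 powi j * of_int (n k)) *\<^sub>R 1 + (2 powi j * of_int (n' k)) *\<^sub>R \<i>)"
      by (simp only: T_field_def X_field_def Y_field_def snd_sum snd_add snd_scaleR snd_conv
          sum_axis scaleR_zero_right add_0_left) (simp only: vec_eq_iff vec_lambda_beta vector_add_component simp_thms)
    then show "snd ?L = snd ?R"
      by (simp only: C snd_conv of_real_power_int of_real_numeral)
  qed
  show ?thesis
    unfolding heis_lattice_def by (intro Collect_cong ex_cong1) (subst heis_exp_eq, subst *, rule refl)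
qed

lemma X_field_left_invariant:
  "((\<lambda>s. heis_mult p (s *\<^sub>R X_field k 0)) has_vector_derivative X_field k p) (at 0)"
proof -
  have A: "(\<Sum>i\<in>UNIV. snd p $ i * cnj ((s *\<^sub>R axis k 1) $ i))
      = (\<Sum>i\<in>UNIV. if i = k then of_real s * snd p $ k else 0)" for s :: real
  proof (rule sum.cong [OF refl])
    show "snd p $ i * cnj ((s *\<^sub>R axis k 1) $ i) = (if i = k then of_real s * snd p $ k else 0)" for i
      by (cases "i = k") (simp_all add: axis_def scaleR_conv_of_real[where 'a = complex])
  qed
  have "(\<lambda>s. heis_mult p (s *\<^sub>R X_field k 0)) = (\<lambda>s. p + s *\<^sub>R X_field k p)"
    by (rule ext) (simp add: heis_mult_def X_field_def prod_eq_iff A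
        del: vector_scaleR_component Im_sum)
  then show ?thesis by (auto intro!: derivative_eq_intros)
qed

lemma Y_field_left_invariant:
  "((\<lambda>s. heis_mult p (s *\<^sub>R Y_field k 0)) has_vector_derivative Y_field k p) (at 0)"
proof -
  have A: "(\<Sum>i\<in>UNIV. snd p $ i * cnj ((s *\<^sub>R axis k \<i>) $ i))
      = (\<Sum>i\<in>UNIV. if i = k then - \<i> * of_real s * snd p $ k else 0)" for s :: real
  proof (rule sum.cong [OF refl])
    show "snd p $ i * cnj ((s *\<^sub>R axis k \<i>) $ i) = (if i = k then - \<i> * of_real s * snd p $ k else 0)" for i
      by (cases "i = k") (simp_all add: axis_def scaleR_conv_of_real[where 'a = complex])
  qed
  have "(\<lambda>s. heis_mult p (s *\<^sub>R Y_field k 0)) = (\<lambda>s. p + s *\<^sub>R Y_field k p)"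
    by (rule ext) (simp add: heis_mult_def Y_field_def prod_eq_iff A
        del: vector_scaleR_component Im_sum)
  then show ?thesis by (auto intro!: derivative_eq_intros)
qed


section \<open>Test functions and distributions\<close>

primrec Ck :: "nat \<Rightarrow> ('a::real_normed_vector \<Rightarrow> 'b::real_normed_vector) \<Rightarrow> bool" where
  "Ck 0 f \<longleftrightarrow> continuous_on UNIV f"
| "Ck (Suc n) f \<longleftrightarrow>
     (\<forall>x. f differentiable (at x)) \<and> (\<forall>v. Ck n (\<lambda>x. frechet_derivative f (at x) v))"

definition test_fun :: "('m::finite heis \<Rightarrow> complex) set" where
  "test_fun = {\<phi>. (\<forall>n. Ck n \<phi>) \<and> compact (closure {x. \<phi> x \<noteq> 0})}"

definition lie_deriv :: "('m::finite heis \<Rightarrow> 'm heis) \<Rightarrow> ('m heis \<Rightarrow> complex) \<Rightarrow> 'm heis \<Rightarrow> complex" where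
  "lie_deriv V f = (\<lambda>p. frechet_derivative f (at p) (V p))"

text \<open>
  Distributions are represented by functionals whose values matter on \<open>test_fun\<close> only. The fields
  \<open>X\<close> and \<open>Y\<close> are divergence free, so the transpose of the derivation along each of them is its
  negative. The pairing is bilinear, without complex conjugation.
\<close>

type_synonym 'm distr = "('m heis \<Rightarrow> complex) \<Rightarrow> complex"

definition distr_of :: "('m::finite heis \<Rightarrow> complex) \<Rightarrow> 'm distr" where
  "distr_of f = (\<lambda>\<phi>. \<integral>x. f x * \<phi> x \<partial>lborel)"

definition dirac :: "'m::finite heis \<Rightarrow> 'm distr" where
  "dirac x = (\<lambda>\<phi>. \<phi> x)"

definition distr_deriv :: "('m::finite heis \<Rightarrow> 'm heis) \<Rightarrow> 'm distr \<Rightarrow> 'm distr" where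
  "distr_deriv V \<Lambda> = (\<lambda>\<phi>. - \<Lambda> (lie_deriv V \<phi>))"

definition distr_subLap :: "'m::finite distr \<Rightarrow> 'm distr" where
  "distr_subLap \<Lambda> = (\<lambda>\<phi>.
     - (\<Sum>k\<in>UNIV. distr_deriv (X_field k) (distr_deriv (X_field k) \<Lambda>) \<phi>)
     - (\<Sum>k\<in>UNIV. distr_deriv (Y_field k) (distr_deriv (Y_field k) \<Lambda>) \<phi>))"


section \<open>The sub-Laplacian in L2 and Sobolev spaces\<close>

definition L2 :: "('m::finite heis \<Rightarrow> complex) set" where
  "L2 = {f \<in> borel_measurable lborel. integrable lborel (\<lambda>x. (norm (f x))\<^sup>2)}"

definition L2_norm :: "('m::finite heis \<Rightarrow> complex) \<Rightarrow> real" where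
  "L2_norm f = sqrt (\<integral>x. (norm (f x))\<^sup>2 \<partial>lborel)"

text \<open>
  Unbounded operators are given by their graphs, on functions rather than on classes modulo null
  sets; \<open>subLap f g\<close> means that \<open>f\<close> is in the domain and \<open>D f = g\<close> almost everywhere.
  The sub-Laplacian is essentially self-adjoint on \<open>test_fun\<close>, so its self-adjoint realization is
  the adjoint of its restriction to \<open>test_fun\<close>: the domain consists of all \<open>f\<close> in \<open>L2\<close> whose
  distributional \<open>D f\<close> is in \<open>L2\<close>.
\<close>

definition subLap :: "('m::finite heis \<Rightarrow> complex) \<Rightarrow> ('m heis \<Rightarrow> complex) \<Rightarrow> bool" where
  "subLap f g \<longleftrightarrow> f \<in> L2 \<and> g \<in> L2 \<and>
     (\<forall>\<phi>\<in>test_fun. distr_subLap (distr_of f) \<phi> = distr_of g \<phi>)"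

definition I_plus_subLap :: "('m::finite heis \<Rightarrow> complex) \<Rightarrow> ('m heis \<Rightarrow> complex) \<Rightarrow> bool" where
  "I_plus_subLap f h \<longleftrightarrow> (\<exists>g. subLap f g \<and> h = (\<lambda>x. f x + g x))"

text \<open>
  \<open>sobolev_even k\<close> is the Sobolev space of order \<open>2 * k\<close>, the domain of the \<open>k\<close>-th power of \<open>I + D\<close>,
  for \<open>k \<ge> 1\<close> (for \<open>k = 0\<close> the relational power does not impose membership in \<open>L2\<close>).
\<close>

definition sobolev_even :: "nat \<Rightarrow> ('m::finite heis \<Rightarrow> complex) set" where
  "sobolev_even k = {f. \<exists>h. (I_plus_subLap ^^ k) f h}"


section \<open>Variational splines\<close>

definition ell2_on :: "'a set \<Rightarrow> ('a \<Rightarrow> complex) set" where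
  "ell2_on A = {y. (\<lambda>x. (norm (y x))\<^sup>2) summable_on A}"

text \<open>For order above half the homogeneous dimension, point values are those of the continuous representative.\<close>

definition interpolants ::
  "nat \<Rightarrow> int \<Rightarrow> ('m::finite heis \<Rightarrow> complex) \<Rightarrow> ('m heis \<Rightarrow> complex) set" where
  "interpolants k j y =
     {u \<in> sobolev_even k. continuous_on UNIV u \<and> (\<forall>x\<in>heis_lattice j. u x = y x)}"

text \<open>The powers of \<open>subLap\<close> are single-valued up to null sets, so the norms below do not depend on \<open>g\<close>, \<open>h\<close>.\<close>

definition is_spline ::
  "nat \<Rightarrow> int \<Rightarrow> ('m::finite heis \<Rightarrow> complex) \<Rightarrow> ('m heis \<Rightarrow> complex) \<Rightarrow> bool" where
  "is_spline k j y s \<longleftrightarrow> s \<in> interpolants k j y \<and>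
     (\<exists>g. (subLap ^^ k) s g \<and>
        (\<forall>u\<in>interpolants k j y. \<forall>h. (subLap ^^ k) u h \<longrightarrow> L2_norm g \<le> L2_norm h))"

end

(* Let g = D^k s. For a test function phi vanishing on the lattice, s + c phi is again an
   interpolant, so g is orthogonal to D^k phi; hence the functional M phi = <D^(2k) s, phi>
   = int g D^k phi depends only on the values of phi on the lattice. Take a bump function with value 1
   at the identity whose support is so small that the lattice translates of the support are disjoint.
   Then phi minus the finite sum of phi(p) times the bump translated to p vanishes on the lattice, so
   M phi = sum alpha_p phi(p), where alpha_p is the value of M on the bump translated to p.
   By left invariance, D^k of a translated bump is the translate of one fixed function, so the
   Cauchy-Schwarz inequality on each of the disjoint supports gives alpha in l2. *)

theory Submission
  imports Defs
begin

section \<open>Smooth functions\<close>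

text \<open>\<open>subLap\<close> records only pairings with test functions, so no regularity of the
  spline is extracted: every power of D is moved onto test functions, where it becomes the classical
  operator \<open>sublap\<close>. Integration by parts serves to put test functions into the domain
  of all powers of D, which makes them admissible perturbations of the spline. Minimality gives
  orthogonality for the Hermitian inner product, whereas distributions use the bilinear pairing. The
  spline is therefore perturbed by the conjugate of phi, which again vanishes on the lattice and
  commutes with D because the fields are real. Square summability needs one Cauchy-Schwarz constant
  for all lattice points. Left translation commutes with D and also preserves Lebesgue measure, so
  D^k of every translated bump has the same L2 norm.\<close>

lemma Ck_SucI:
  assumes "\<And>x. (f has_derivative D x) (at x)" and "\<And>v. Ck n (\<lambda>x. D x v)"
  shows "Ck (Suc n) f"
proof -
  have "frechet_derivative f (at x) = D x" for x
    using frechet_derivative_at[OF assms(1)] by simp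
  then show ?thesis
    using assms by (auto simp: differentiable_def)
qed

lemma Ck_Suc_has_derivative:
  "Ck (Suc n) f \<Longrightarrow> (f has_derivative frechet_derivative f (at x)) (at x)"
  using frechet_derivative_works by auto

lemma Ck_SucD: "Ck (Suc n) f \<Longrightarrow> Ck n f"
proof (induction n arbitrary: f)
  case 0
  then show ?case
    by (auto intro!: continuous_at_imp_continuous_on differentiable_imp_continuous_within)
next
  case (Suc n)
  then show ?case using Ck.simps(2)[of n f] Ck.simps(2)[of "Suc n" f] by blast
qed

lemma Ck_continuous: "Ck n f \<Longrightarrow> continuous_on UNIV f"
  by (induction n) (auto dest: Ck_SucD simp del: Ck.simps(2))

lemma Ck_const: "Ck n (\<lambda>x. c)"
proof (induction n arbitrary: c)
  case (Suc n)
  then show ?case by (intro Ck_SucI[where D="\<lambda>_ _. 0"]) auto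
qed simp

lemma Ck_bounded_linear: "bounded_linear L \<Longrightarrow> Ck n L"
proof (cases n)
  case 0
  assume "bounded_linear L"
  then show ?thesis by (simp add: 0 linear_continuous_on)
next
  case (Suc k)
  assume "bounded_linear L"
  then show ?thesis unfolding Suc
    by (intro Ck_SucI[where D="\<lambda>_. L"] bounded_linear_imp_has_derivative Ck_const)
qed

lemma Ck_add: "Ck n f \<Longrightarrow> Ck n g \<Longrightarrow> Ck n (\<lambda>x. f x + g x)"
proof (induction n arbitrary: f g)
  case (Suc n)
  show ?case
  proof (rule Ck_SucI)
    show "((\<lambda>x. f x + g x) has_derivative
        (\<lambda>v. frechet_derivative f (at x) v + frechet_derivative g (at x) v)) (at x)" for x
      by (intro has_derivative_add Ck_Suc_has_derivative[OF Suc.prems(1)] Ck_Suc_has_derivative[OF Suc.prems(2)])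
    show "Ck n (\<lambda>x. frechet_derivative f (at x) v + frechet_derivative g (at x) v)" for v
      using Suc by simp
  qed
qed (simp add: continuous_on_add)

lemma Ck_linear_comp:
  assumes "bounded_linear L"
  shows "Ck n f \<Longrightarrow> Ck n (\<lambda>x. L (f x))"
proof (induction n arbitrary: f)
  case 0
  then show ?case
    by (auto intro: bounded_linear.continuous_on[OF assms])
next
  case (Suc n)
  show ?case
  proof (rule Ck_SucI)
    show "((\<lambda>x. L (f x)) has_derivative (\<lambda>v. L (frechet_derivative f (at x) v))) (at x)" for x
      by (intro bounded_linear.has_derivative[OF assms] Ck_Suc_has_derivative[OF Suc.prems])
    show "Ck n (\<lambda>x. L (frechet_derivative f (at x) v))" for v
      using Suc by simp
  qed
qed

lemma Ck_mult:
  fixes f g :: "'a::real_normed_vector \<Rightarrow> 'b::real_normed_algebra"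
  shows "Ck n f \<Longrightarrow> Ck n g \<Longrightarrow> Ck n (\<lambda>x. f x * g x)"
proof (induction n arbitrary: f g)
  case (Suc n)
  show ?case
  proof (rule Ck_SucI)
    show "((\<lambda>x. f x * g x) has_derivative
        (\<lambda>v. f x * frechet_derivative g (at x) v + frechet_derivative f (at x) v * g x)) (at x)" for x
      by (intro has_derivative_mult Ck_Suc_has_derivative[OF Suc.prems(1)] Ck_Suc_has_derivative[OF Suc.prems(2)])
    show "Ck n (\<lambda>x. f x * frechet_derivative g (at x) v + frechet_derivative f (at x) v * g x)" for v
      using Suc Suc.prems[THEN Ck_SucD] by (intro Ck_add Suc.IH) auto
  qed
qed (simp add: continuous_on_mult)

text \<open>The derivative \<open>L\<close> of an affine map is constant, so differentiating
  \<open>f (A x)\<close> along \<open>v\<close> gives a function of the same shape, with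
  \<open>f\<close> replaced by its derivative along \<open>L v\<close>; the induction closes without
  products. Left translations of the group are of this kind.\<close>

lemma Ck_comp_affine:
  fixes A L :: "'a::real_normed_vector \<Rightarrow> 'b::real_normed_vector"
  assumes L: "bounded_linear L" and A: "\<And>x. A x = a + L x"
  shows "Ck n f \<Longrightarrow> Ck n (\<lambda>x. f (A x))"
proof (induction n arbitrary: f)
  case 0
  have "continuous_on UNIV A"
    unfolding A using L by (intro continuous_intros linear_continuous_on)
  with 0 show ?case
    by (auto intro: continuous_on_compose2)
next
  case (Suc n)
  have dA: "(A has_derivative L) (at x)" for x
    using has_derivative_add[OF has_derivative_const[of a] bounded_linear_imp_has_derivative[OF L]]
    by (simp add: A[abs_def])
  show ?case
  proof (rule Ck_SucI)
    show "((\<lambda>x. f (A x)) has_derivative (\<lambda>v. frechet_derivative f (at (A x)) (L v))) (at x)" for x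
      by (rule has_derivative_compose[OF dA Ck_Suc_has_derivative[OF Suc.prems]])
    show "Ck n (\<lambda>x. frechet_derivative f (at (A x)) (L v))" for v
      using Suc.prems by (intro Suc.IH) auto
  qed
qed

section \<open>A smooth cutoff built from exp(-1/t)\<close>

text \<open>The family is closed under differentiation up to linear combinations, so one induction handles
  all derivatives of the bump function at once.\<close>

definition flat :: "nat \<Rightarrow> real \<Rightarrow> real" where
  "flat i t = (if t \<le> 0 then 0 else exp (- inverse t) * inverse t ^ i)"

lemma flat_0: "flat i 0 = 0"
  by (simp add: flat_def)

text \<open>With u = 1/t, a single term of the exponential series gives u^(i+2) / (i+2)! \<le> exp
  u. The exponent i+2 rather than i leaves a factor t^2, which makes the difference quotient at 0
  tend to 0.\<close>

lemma flat_bound: "\<bar>flat i t\<bar> \<le> fact (i + 2) * t\<^sup>2"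
proof (cases "t \<le> 0")
  case False
  define u where "u = inverse t"
  define K :: real where "K = fact (i + 2)"
  have u: "u > 0" "t = inverse u" and K: "K > 0" using False by (auto simp: u_def K_def)
  have "u ^ (i + 2) / K \<le> exp u"
    using sum_le_suminf[OF sums_summable[OF exp_converges[of u]], of "{i + 2}"] exp_converges[of u] u(1)
    by (simp add: sums_iff divide_inverse mult.commute K_def del: fact_Suc)
  then have "u ^ (i + 2) \<le> K * exp u" using K by (simp add: divide_le_eq mult.commute)
  then have "exp (- u) * u ^ i * u\<^sup>2 \<le> exp (- u) * (K * exp u)"
    by (simp add: power_add power2_eq_square mult_ac)
  also have "exp (- u) * (K * exp u) = K" by (simp add: exp_minus)
  finally have "exp (- u) * u ^ i \<le> K * (inverse u)\<^sup>2"
    using u(1) by (simp add: divide_inverse[symmetric] power_inverse pos_le_divide_eq)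
  then show ?thesis using False by (simp add: flat_def u_def K_def del: fact_Suc)
qed (simp add: flat_def)

text \<open>Away from 0 this is the product rule; at 0, where the two formulas meet, the quadratic
  bound forces the derivative to be 0.\<close>

lemma flat_deriv: "(flat i has_real_derivative flat (i + 2) t - real i * flat (i + 1) t) (at t)"
proof -
  consider "t < 0" | "t = 0" | "t > 0" by linarith
  then show ?thesis
  proof cases
    case 1
    have "((\<lambda>_. 0) has_real_derivative 0) (at t)" by simp
    then have "(flat i has_real_derivative 0) (at t)"
      by (rule has_field_derivative_transform_within_open[where S="{..<0}"])
        (use 1 in \<open>auto simp: flat_def\<close>)
    with 1 show ?thesis by (simp add: flat_def)
  next
    case 2
    have "((\<lambda>h. (flat i (0 + h) - flat i 0) / h) \<longlongrightarrow> 0) (at 0)"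
    proof (rule Lim_null_comparison)
      show "\<forall>\<^sub>F h in at 0. norm ((flat i (0 + h) - flat i 0) / h) \<le> fact (i + 2) * \<bar>h\<bar>"
      proof (rule always_eventually, rule allI)
        fix h :: real
        show "norm ((flat i (0 + h) - flat i 0) / h) \<le> fact (i + 2) * \<bar>h\<bar>"
        proof (cases "h = 0")
          case False
          have "\<bar>flat i h\<bar> / \<bar>h\<bar> \<le> fact (i + 2) * h\<^sup>2 / \<bar>h\<bar>"
            by (intro divide_right_mono flat_bound) simp
          also have "fact (i + 2) * h\<^sup>2 / \<bar>h\<bar> = fact (i + 2) * \<bar>h\<bar>"
            using abs_mult_self_eq[of h] False
            by (simp add: power2_eq_square del: fact_Suc abs_mult_self_eq)
              (metis abs_eq_0 nonzero_mult_div_cancel_right times_divide_eq_right)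
          finally show ?thesis by (simp add: flat_0 del: fact_Suc)
        qed simp
      qed
      show "((\<lambda>h. fact (i + 2) * \<bar>h\<bar>) \<longlongrightarrow> 0) (at (0::real))"
        by (auto intro!: tendsto_eq_intros)
    qed
    then have "(flat i has_real_derivative 0) (at 0)" by (simp add: DERIV_def)
    with 2 show ?thesis by (simp add: flat_def)
  next
    case 3
    have inv: "(inverse has_real_derivative - (inverse t * inverse t)) (at t)"
      using DERIV_inverse[of t UNIV] 3 by (simp add: power2_eq_square)
    have pow: "((\<lambda>t. inverse t ^ i) has_real_derivative - real i * inverse t ^ (i + 1)) (at t)"
      by (rule DERIV_cong[OF DERIV_power[OF inv]]) (cases i; simp add: algebra_simps)
    have "((\<lambda>t. exp (- inverse t) * inverse t ^ i) has_real_derivative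
        exp (- inverse t) * inverse t ^ (i + 2) - real i * (exp (- inverse t) * inverse t ^ (i + 1))) (at t)"
      by (rule DERIV_cong[OF DERIV_mult[OF DERIV_fun_exp[OF DERIV_minus[OF inv]] pow]])
        (simp add: algebra_simps)
    then have "(flat i has_real_derivative
        exp (- inverse t) * inverse t ^ (i + 2) - real i * (exp (- inverse t) * inverse t ^ (i + 1))) (at t)"
      by (rule has_field_derivative_transform_within_open[where S="{0<..}"])
        (use 3 in \<open>auto simp: flat_def\<close>)
    with 3 show ?thesis by (simp add: flat_def)
  qed
qed

text \<open>The squared norm is used because it is smooth at the origin as well. Its derivative
  contributes the linear factor -2 (x . v), and the index \<open>i\<close> must be arbitrary because
  differentiation raises it by 1 and by 2.\<close>

lemma Ck_flat_paraboloid: "Ck n (\<lambda>x::'a::real_inner. flat i (r - x \<bullet> x))"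
proof (induction n arbitrary: i)
  case 0
  have "continuous_on UNIV (flat i)"
    by (rule DERIV_continuous_on[where D="\<lambda>t. flat (i + 2) t - real i * flat (i + 1) t"]) (use flat_deriv in auto)
  then show ?case
    by (auto intro!: continuous_on_compose2[where g="flat i" and t=UNIV] continuous_intros)
next
  case (Suc n)
  show ?case
  proof (rule Ck_SucI)
    fix x :: 'a
    have "((\<lambda>x::'a. r - x \<bullet> x) has_derivative (\<lambda>v. - 2 * (x \<bullet> v))) (at x)"
      by (auto intro!: derivative_eq_intros simp: inner_commute)
    note has_derivative_compose[OF this flat_deriv[of i "r - x \<bullet> x", unfolded has_field_derivative_def]]
    then show "((\<lambda>x. flat i (r - x \<bullet> x)) has_derivative
        (\<lambda>v. (flat (i + 2) (r - x \<bullet> x) + (- real i) * flat (i + 1) (r - x \<bullet> x)) * (- 2 * (x \<bullet> v)))) (at x)"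
      by simp
  next
    fix v :: 'a
    have a: "Ck n (\<lambda>x::'a. flat (i + 2) (r - x \<bullet> x) + (- real i) * flat (i + 1) (r - x \<bullet> x))"
      by (intro Ck_add Ck_mult[OF Ck_const] Suc.IH)
    have b: "Ck n (\<lambda>x. - 2 * (x \<bullet> v))"
      using Ck_bounded_linear[OF bounded_linear_compose[OF bounded_linear_mult_right[of "-2"] bounded_linear_inner_left]] .
    show "Ck n (\<lambda>x. (flat (i + 2) (r - x \<bullet> x) + (- real i) * flat (i + 1) (r - x \<bullet> x)) * (- 2 * (x \<bullet> v)))"
      by (rule Ck_mult[OF a b])
  qed
qed

section \<open>Left-invariant horizontal fields on test functions\<close>

text \<open>The left-invariant field with value (0, e) at the identity, in coordinate-free form, so
  that the fields X and Y are treated together.\<close>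

definition horizontal :: "complex ^ 'm \<Rightarrow> 'm::finite heis \<Rightarrow> 'm heis" where
  "horizontal e p = (2 * Im (\<Sum>k\<in>UNIV. snd p $ k * cnj (e $ k)), e)"

lemma X_field_horizontal: "X_field k = horizontal (axis k 1)"
proof
  fix p :: "'a heis"
  have "(\<Sum>i\<in>UNIV. snd p $ i * cnj (axis k 1 $ i)) = (\<Sum>i\<in>UNIV. if i = k then snd p $ k else 0)"
    by (rule sum.cong) (auto simp: axis_def)
  then show "X_field k p = horizontal (axis k 1) p"
    by (simp add: X_field_def horizontal_def del: Im_sum)
qed

lemma Y_field_horizontal: "Y_field k = horizontal (axis k \<i>)"
proof
  fix p :: "'a heis"
  have "(\<Sum>i\<in>UNIV. snd p $ i * cnj (axis k \<i> $ i)) = (\<Sum>i\<in>UNIV. if i = k then - \<i> * snd p $ k else 0)"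
    by (rule sum.cong) (auto simp: axis_def)
  then show "Y_field k p = horizontal (axis k \<i>) p"
    by (simp add: Y_field_def horizontal_def del: Im_sum)
qed

lemma bounded_linear_symplectic:
  "bounded_linear (\<lambda>z :: complex ^ 'm::finite. 2 * Im (\<Sum>k\<in>UNIV. z $ k * cnj (e $ k)))"
  by (intro bounded_linear_compose[OF bounded_linear_mult_right] bounded_linear_compose[OF bounded_linear_Im]
      bounded_linear_sum bounded_linear_compose[OF bounded_linear_mult_left] bounded_linear_vec_nth)

lemma bounded_linear_symplectic_right:
  "bounded_linear (\<lambda>z :: complex ^ 'm::finite. 2 * Im (\<Sum>k\<in>UNIV. e $ k * cnj (z $ k)))"
  by (intro bounded_linear_compose[OF bounded_linear_mult_right] bounded_linear_compose[OF bounded_linear_Im]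
      bounded_linear_sum bounded_linear_compose[OF bounded_linear_mult_right]
      bounded_linear_compose[OF bounded_linear_cnj] bounded_linear_vec_nth)

section \<open>Closure properties of test functions\<close>

lemma test_fun_Ck: "\<phi> \<in> test_fun \<Longrightarrow> Ck n \<phi>"
  by (simp add: test_fun_def)

lemma test_fun_has_derivative:
  "\<phi> \<in> test_fun \<Longrightarrow> (\<phi> has_derivative frechet_derivative \<phi> (at x)) (at x)"
  using Ck_Suc_has_derivative[of 0 \<phi> x] test_fun_Ck[of \<phi> "Suc 0"] by blast

lemma test_funI:
  fixes \<phi> :: "'m::finite heis \<Rightarrow> complex"
  assumes "\<And>n. Ck n \<phi>" and "bounded K" and "\<And>x. x \<notin> K \<Longrightarrow> \<phi> x = 0"
  shows "\<phi> \<in> test_fun"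
proof -
  have "{x. \<phi> x \<noteq> 0} \<subseteq> K" using assms(3) by blast
  then have "bounded {x. \<phi> x \<noteq> 0}" using assms(2) bounded_subset by blast
  then show ?thesis using assms(1) by (simp add: test_fun_def)
qed

lemma test_fun_support:
  assumes "\<phi> \<in> test_fun"
  obtains K where "compact K" "\<And>x. x \<notin> K \<Longrightarrow> \<phi> x = 0"
proof
  show "compact (closure {x. \<phi> x \<noteq> 0})" using assms by (simp add: test_fun_def)
  show "\<phi> x = 0" if "x \<notin> closure {x. \<phi> x \<noteq> 0}" for x
    using that closure_subset[of "{x. \<phi> x \<noteq> 0}"] by auto
qed

lemma frechet_derivative_zero_outside:
  assumes "closed K" and "\<And>x. x \<notin> K \<Longrightarrow> f x = 0" and "x \<notin> K"
  shows "frechet_derivative f (at x) = (\<lambda>v. 0)"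
proof -
  have "(f has_derivative (\<lambda>v. 0)) (at x)"
    by (rule has_derivative_transform_within_open[OF has_derivative_const[of 0], of "- K"])
      (use assms in auto)
  then show ?thesis by (rule frechet_derivative_at[symmetric])
qed

lemma lie_deriv_zero_outside:
  "closed K \<Longrightarrow> (\<And>x. x \<notin> K \<Longrightarrow> f x = 0) \<Longrightarrow> x \<notin> K \<Longrightarrow> lie_deriv V f x = 0"
  by (simp add: lie_deriv_def frechet_derivative_zero_outside[of K])

lemma test_fun_lincomb:
  assumes "f \<in> test_fun" "g \<in> test_fun"
  shows "(\<lambda>x. f x + c * g x) \<in> test_fun"
proof -
  obtain K where K: "compact K" "\<And>x. x \<notin> K \<Longrightarrow> f x = 0" using test_fun_support[OF assms(1)] by metis
  obtain K' where K': "compact K'" "\<And>x. x \<notin> K' \<Longrightarrow> g x = 0" using test_fun_support[OF assms(2)] by metis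
  show ?thesis
    by (rule test_funI[of _ "K \<union> K'"])
      (auto simp: K K' compact_imp_bounded intro!: Ck_add Ck_mult Ck_const test_fun_Ck[OF assms(1)] test_fun_Ck[OF assms(2)])
qed

lemma test_fun_zero: "(\<lambda>x. 0) \<in> test_fun"
  by (rule test_funI[of _ "{}"]) (auto intro: Ck_const)

lemma test_fun_sum:
  "finite A \<Longrightarrow> (\<And>i. i \<in> A \<Longrightarrow> f i \<in> test_fun) \<Longrightarrow> (\<lambda>x. \<Sum>i\<in>A. c i * f i x) \<in> test_fun"
proof (induction A rule: finite_induct)
  case (insert i A)
  then have "(\<lambda>x. (\<Sum>i\<in>A. c i * f i x) + c i * f i x) \<in> test_fun"
    by (intro test_fun_lincomb) auto
  then show ?case using insert by (simp add: add.commute)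
qed (simp add: test_fun_zero)

lemma test_fun_mult:
  assumes "f \<in> test_fun" "\<And>n. Ck n g"
  shows "(\<lambda>x. f x * g x) \<in> test_fun"
proof -
  obtain K where K: "compact K" "\<And>x. x \<notin> K \<Longrightarrow> f x = 0" using test_fun_support[OF assms(1)] by metis
  show ?thesis
    by (rule test_funI[of _ K])
      (auto simp: K compact_imp_bounded intro!: Ck_mult test_fun_Ck[OF assms(1)] assms(2))
qed

lemma test_fun_cnj: "f \<in> test_fun \<Longrightarrow> (\<lambda>x. cnj (f x)) \<in> test_fun"
  by (auto simp: test_fun_def intro: Ck_linear_comp bounded_linear_cnj)

lemma test_fun_frechet:
  assumes "f \<in> test_fun"
  shows "(\<lambda>x. frechet_derivative f (at x) v) \<in> test_fun"
proof -
  obtain K where K: "compact K" "\<And>x. x \<notin> K \<Longrightarrow> f x = 0" using test_fun_support[OF assms] by metis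
  show ?thesis
  proof (rule test_funI[of _ K])
    show "Ck n (\<lambda>x. frechet_derivative f (at x) v)" for n
      using test_fun_Ck[OF assms, of "Suc n"] by (simp del: split_paired_All)
  qed (use K in \<open>auto simp: compact_imp_bounded compact_imp_closed frechet_derivative_zero_outside[of K]\<close>)
qed

text \<open>\<open>Ck\<close> controls derivatives in a fixed direction only, while the direction
  \<open>horizontal e p\<close> moves with \<open>p\<close>. Splitting off its vertical part leaves
  two fixed directions, the second with a smooth (linear) coefficient.\<close>

lemma lie_deriv_horizontal:
  assumes "f \<in> test_fun"
  shows "lie_deriv (horizontal e) f = (\<lambda>p. frechet_derivative f (at p) (0, e)
    + frechet_derivative f (at p) (1, 0) * of_real (2 * Im (\<Sum>k\<in>UNIV. snd p $ k * cnj (e $ k))))"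
proof
  fix p :: "'a heis"
  define r where "r = 2 * Im (\<Sum>k\<in>UNIV. snd p $ k * cnj (e $ k))"
  have "linear (frechet_derivative f (at p))"
    by (rule has_derivative_linear[OF test_fun_has_derivative[OF assms]])
  then have "frechet_derivative f (at p) ((0, e) + r *\<^sub>R (1, 0))
      = frechet_derivative f (at p) (0, e) + r *\<^sub>R frechet_derivative f (at p) (1, 0)"
    by (simp only: linear_add linear_scale)
  moreover have "horizontal e p = (0, e) + r *\<^sub>R (1, 0)"
    by (simp add: horizontal_def r_def del: Im_sum)
  ultimately show "lie_deriv (horizontal e) f p = frechet_derivative f (at p) (0, e)
    + frechet_derivative f (at p) (1, 0) * of_real (2 * Im (\<Sum>k\<in>UNIV. snd p $ k * cnj (e $ k)))"
    by (simp only: lie_deriv_def r_def scaleR_conv_of_real mult.commute)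
qed

lemma Ck_symplectic:
  "Ck n (\<lambda>p :: 'm::finite heis. complex_of_real (2 * Im (\<Sum>k\<in>UNIV. snd p $ k * cnj (e $ k))))"
  by (rule Ck_bounded_linear[OF bounded_linear_compose[OF bounded_linear_of_real
        bounded_linear_compose[OF bounded_linear_symplectic bounded_linear_snd]]])

lemma test_fun_lie_deriv:
  assumes "f \<in> test_fun"
  shows "lie_deriv (horizontal e) f \<in> test_fun"
proof -
  have "(\<lambda>p. frechet_derivative f (at p) (0, e) + 1 * (frechet_derivative f (at p) (1, 0)
      * of_real (2 * Im (\<Sum>k\<in>UNIV. snd p $ k * cnj (e $ k))))) \<in> test_fun"
    by (intro test_fun_lincomb test_fun_mult test_fun_frechet assms Ck_symplectic)
  then show ?thesis by (simp only: lie_deriv_horizontal[OF assms] mult_1_left)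
qed

lemma lie_deriv_lincomb:
  assumes "f \<in> test_fun" "g \<in> test_fun"
  shows "lie_deriv V (\<lambda>x. f x + c * g x) = (\<lambda>p. lie_deriv V f p + c * lie_deriv V g p)"
proof
  fix p
  have "((\<lambda>x. f x + c * g x) has_derivative
      (\<lambda>v. frechet_derivative f (at p) v + c * frechet_derivative g (at p) v)) (at p)"
    by (intro has_derivative_add has_derivative_mult_right test_fun_has_derivative assms)
  note D = frechet_derivative_at[OF this, symmetric]
  show "lie_deriv V (\<lambda>x. f x + c * g x) p = lie_deriv V f p + c * lie_deriv V g p"
    by (simp only: lie_deriv_def D)
qed

lemma lie_deriv_cnj:
  assumes "f \<in> test_fun"
  shows "lie_deriv V (\<lambda>x. cnj (f x)) = (\<lambda>p. cnj (lie_deriv V f p))"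
proof
  fix p
  have "((\<lambda>x. cnj (f x)) has_derivative (\<lambda>v. cnj (frechet_derivative f (at p) v))) (at p)"
    by (intro bounded_linear.has_derivative[OF bounded_linear_cnj] test_fun_has_derivative assms)
  note D = frechet_derivative_at[OF this, symmetric]
  show "lie_deriv V (\<lambda>x. cnj (f x)) p = cnj (lie_deriv V f p)"
    by (simp only: lie_deriv_def D)
qed

lemma lie_deriv_mult:
  assumes "f \<in> test_fun" "g \<in> test_fun"
  shows "lie_deriv V (\<lambda>x. f x * g x) = (\<lambda>p. f p * lie_deriv V g p + lie_deriv V f p * g p)"
proof
  fix p
  have "((\<lambda>x. f x * g x) has_derivative
      (\<lambda>v. f p * frechet_derivative g (at p) v + frechet_derivative f (at p) v * g p)) (at p)"
    by (intro has_derivative_mult test_fun_has_derivative assms)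
  note D = frechet_derivative_at[OF this, symmetric]
  show "lie_deriv V (\<lambda>x. f x * g x) p = f p * lie_deriv V g p + lie_deriv V f p * g p"
    by (simp only: lie_deriv_def D)
qed

subsection \<open>Left translation\<close>

text \<open>Left translation by \<open>a\<close> is affine in these coordinates; this is its linear
  part, hence its differential at every point.\<close>

definition left_shear :: "'m::finite heis \<Rightarrow> 'm heis \<Rightarrow> 'm heis" where
  "left_shear a v = (fst v + 2 * Im (\<Sum>k\<in>UNIV. snd a $ k * cnj (snd v $ k)), snd v)"

lemma heis_mult_left_shear: "heis_mult a x = a + left_shear a x"
  by (simp add: heis_mult_def left_shear_def prod_eq_iff del: Im_sum)

lemma bounded_linear_left_shear: "bounded_linear (left_shear a)"
  unfolding left_shear_def
  by (rule bounded_linear_Pair[OF bounded_linear_add[OF bounded_linear_fst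
        bounded_linear_compose[OF bounded_linear_symplectic_right bounded_linear_snd]] bounded_linear_snd])

text \<open>This is left invariance: the differential of the translation carries the field at
  \<open>p\<close> to the field at the translated point.\<close>

lemma left_shear_horizontal: "left_shear a (horizontal e p) = horizontal e (heis_mult a p)"
  by (simp add: left_shear_def horizontal_def heis_mult_def distrib_right sum.distrib
      del: Im_sum)

text \<open>The group inverse is the negative, since the twist of a vector with itself is the
  imaginary part of a squared norm.\<close>

lemma heis_mult_uminus: "heis_mult (- a) (heis_mult a x) = x" "heis_mult a (heis_mult (- a) x) = x"
proof -
  have im: "Im (\<Sum>k\<in>UNIV. snd a $ k * cnj (snd a $ k)) = 0"
    by (simp add: mult.commute)
  show "heis_mult (- a) (heis_mult a x) = x" "heis_mult a (heis_mult (- a) x) = x"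
    by (simp_all add: heis_mult_def prod_eq_iff distrib_left right_diff_distrib sum.distrib sum_subtractf sum_negf im del: Im_sum)
qed

lemma has_derivative_heis_mult: "(heis_mult a has_derivative left_shear a) (at p)"
proof -
  have "((\<lambda>x. a + left_shear a x) has_derivative (\<lambda>x. 0 + left_shear a x)) (at p)"
    by (intro has_derivative_add has_derivative_const bounded_linear_imp_has_derivative
        bounded_linear_left_shear)
  then show ?thesis by (simp add: heis_mult_left_shear[abs_def])
qed

lemma continuous_heis_mult: "continuous_on S (heis_mult a)"
  by (rule has_derivative_continuous_on[OF has_derivative_at_withinI[OF has_derivative_heis_mult]])

lemma test_fun_translate:
  assumes "f \<in> test_fun"
  shows "(\<lambda>x. f (heis_mult a x)) \<in> test_fun"
proof -
  obtain K where K: "compact K" "\<And>x. x \<notin> K \<Longrightarrow> f x = 0" using test_fun_support[OF assms] by metis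
  show ?thesis
  proof (rule test_funI[of _ "heis_mult (- a) ` K"])
    show "Ck n (\<lambda>x. f (heis_mult a x))" for n
      by (rule Ck_comp_affine[OF bounded_linear_left_shear heis_mult_left_shear test_fun_Ck[OF assms]])
    show "bounded (heis_mult (- a) ` K)"
      by (intro compact_imp_bounded compact_continuous_image continuous_heis_mult K)
    show "f (heis_mult a x) = 0" if "x \<notin> heis_mult (- a) ` K" for x
      using that K(2)[of "heis_mult a x"] heis_mult_uminus(1)[of a x] by (metis image_eqI)
  qed
qed

lemma lie_deriv_translate:
  assumes "f \<in> test_fun"
  shows "lie_deriv (horizontal e) (\<lambda>x. f (heis_mult a x))
    = (\<lambda>p. lie_deriv (horizontal e) f (heis_mult a p))"
proof
  fix p
  have "((\<lambda>x. f (heis_mult a x)) has_derivative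
      (\<lambda>v. frechet_derivative f (at (heis_mult a p)) (left_shear a v))) (at p)"
    by (rule has_derivative_compose[OF has_derivative_heis_mult test_fun_has_derivative[OF assms]])
  note D = frechet_derivative_at[OF this, symmetric]
  show "lie_deriv (horizontal e) (\<lambda>x. f (heis_mult a x)) p = lie_deriv (horizontal e) f (heis_mult a p)"
    by (simp only: lie_deriv_def D left_shear_horizontal)
qed

section \<open>Integration by parts\<close>

lemma integrable_compact_support:
  fixes f :: "'a::euclidean_space \<Rightarrow> 'b::{banach, second_countable_topology}"
  assumes "continuous_on UNIV f" "compact K" "\<And>x. x \<notin> K \<Longrightarrow> f x = 0"
  shows "integrable lborel f"
proof -
  have "integrable lborel (\<lambda>x. indicator K x *\<^sub>R f x)"
    using assms continuous_on_subset by (blast intro: borel_integrable_compact)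
  moreover have "(\<lambda>x. indicator K x *\<^sub>R f x) = f"
    using assms(3) by (auto simp: fun_eq_iff indicator_def)
  ultimately show ?thesis by simp
qed

lemma test_fun_continuous: "f \<in> test_fun \<Longrightarrow> continuous_on UNIV f"
  using Ck_continuous test_fun_Ck by blast

lemma test_fun_integrable: "f \<in> test_fun \<Longrightarrow> integrable lborel f"
  by (metis test_fun_support test_fun_continuous integrable_compact_support)

lemma test_fun_L2:
  fixes f :: "'m::finite heis \<Rightarrow> complex"
  assumes "f \<in> test_fun"
  shows "f \<in> L2"
proof -
  obtain K where K: "compact K" "\<And>x. x \<notin> K \<Longrightarrow> f x = 0" using test_fun_support[OF assms] by metis
  have "integrable lborel (\<lambda>x. (norm (f x))\<^sup>2)"
    by (rule integrable_compact_support[OF _ K(1)])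
      (auto intro!: continuous_intros test_fun_continuous assms simp: K(2))
  moreover have "f \<in> borel_measurable lborel"
    using borel_measurable_continuous_onI[OF test_fun_continuous[OF assms]] by simp
  ultimately show ?thesis by (simp add: L2_def)
qed

lemma integral_translate:
  fixes f :: "'a::euclidean_space \<Rightarrow> 'b::{banach, second_countable_topology}"
  assumes "f \<in> borel_measurable borel"
  shows "(\<integral>x. f (c + x) \<partial>lborel) = (\<integral>x. f x \<partial>lborel)"
  using integral_distr[of "(+) c" lborel borel f] assms by (simp add: lborel_distr_plus)

lemma test_fun_bounded:
  assumes "f \<in> test_fun"
  obtains M where "0 \<le> M" "\<And>x. norm (f x) \<le> M"
proof -
  obtain K where K: "compact K" "\<And>x. x \<notin> K \<Longrightarrow> f x = 0" using test_fun_support[OF assms] by metis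
  have "compact (f ` K)"
    using K(1) test_fun_continuous[OF assms] compact_continuous_image continuous_on_subset by blast
  then obtain M where M: "\<forall>y\<in>f ` K. norm y \<le> M"
    using compact_imp_bounded bounded_iff by metis
  have "norm (f x) \<le> max 0 M" for x
    using M K(2)[of x] by (cases "x \<in> K") (auto simp: le_max_iff_disj)
  then show ?thesis using that[of "max 0 M"] by simp
qed

lemma has_derivative_along_line:
  assumes "(f has_derivative D) (at (x + t *\<^sub>R v))"
  shows "((\<lambda>t. f (x + t *\<^sub>R v)) has_derivative (\<lambda>s. s *\<^sub>R D v)) (at t)"
proof -
  have "((\<lambda>t. x + t *\<^sub>R v) has_derivative (\<lambda>s. s *\<^sub>R v)) (at t)"
    by (auto intro!: derivative_eq_intros)
  from has_derivative_compose[OF this assms]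
  show ?thesis using linear_scale[OF has_derivative_linear[OF assms]] by simp
qed

text \<open>Translation invariance of Lebesgue measure makes the integral of every difference
  quotient 0; dominated convergence passes to the derivative.\<close>

lemma integral_frechet_derivative:
  fixes f :: "'m::finite heis \<Rightarrow> complex"
  assumes f: "f \<in> test_fun"
  shows "(\<integral>x. frechet_derivative f (at x) v \<partial>lborel) = 0"
proof -
  let ?D = "\<lambda>x. frechet_derivative f (at x) v"
  have D: "?D \<in> test_fun" by (rule test_fun_frechet[OF f])
  obtain M where M: "0 \<le> M" "\<And>x. norm (?D x) \<le> M" using test_fun_bounded[OF D] by metis
  obtain K where K: "compact K" "\<And>x. x \<notin> K \<Longrightarrow> f x = 0" using test_fun_support[OF f] by metis
  obtain R where R: "\<And>x. x \<in> K \<Longrightarrow> norm x \<le> R"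
    using compact_imp_bounded[OF K(1)] bounded_iff by metis
  \<comment> \<open>Steps of length at most 1, so that all difference quotients vanish outside one
    common ball of radius \<open>R + norm v\<close>.\<close>
  define h where "h n = inverse (real (Suc n))" for n
  have h: "0 < h n" "h n \<le> 1" for n
    using inverse_le_1_iff[of "real (Suc n)"] by (auto simp: h_def)
  define q where "q n x = (f (h n *\<^sub>R v + x) - f x) /\<^sub>R h n" for n x
  have meas: "f \<in> borel_measurable borel" "?D \<in> borel_measurable borel"
    using f D by (auto intro: borel_measurable_continuous_onI test_fun_continuous)
  have line: "((\<lambda>t. f (x + t *\<^sub>R v)) has_derivative (\<lambda>s. s *\<^sub>R ?D (x + t *\<^sub>R v))) (at t)" for x t
    by (rule has_derivative_along_line[OF test_fun_has_derivative[OF f]])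
  \<comment> \<open>Inside the ball the mean value inequality applies; outside it both evaluation
    points lie beyond the support of \<open>f\<close>.\<close>
  have bound: "norm (q n x) \<le> M * indicator (cball 0 (R + norm v)) x" for n x
  proof (cases "x \<in> cball 0 (R + norm v)")
    case True
    have "norm (f (x + h n *\<^sub>R v) - f (x + 0 *\<^sub>R v)) \<le> M * norm (h n - 0)"
      by (rule differentiable_bound[OF convex_UNIV has_derivative_at_withinI[OF line]])
        (auto intro!: onorm_bound M mult_left_mono simp: mult.commute[of M])
    moreover have "norm (q n x) = norm (f (x + h n *\<^sub>R v) - f x) / h n"
      using h[of n] by (simp add: q_def add.commute divide_inverse mult.commute)
    ultimately show ?thesis using True h[of n] by (simp add: pos_divide_le_eq)
  next
    case False
    have "norm (h n *\<^sub>R v) \<le> norm v" using h[of n] mult_right_mono[of "h n" 1 "norm v"] by simp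
    then have "norm (h n *\<^sub>R v + x) > R" "norm x > R"
      using False norm_triangle_ineq2[of x "- h n *\<^sub>R v"] norm_ge_zero[of v]
      by (auto simp: add.commute simp del: norm_ge_zero norm_scaleR)
    then have "f (h n *\<^sub>R v + x) = 0" "f x = 0" using R K(2) by (meson not_less)+
    then show ?thesis using False by (simp add: q_def)
  qed
  have lim: "(\<lambda>n. q n x) \<longlonglongrightarrow> ?D x" for x
  proof -
    have "((\<lambda>t. norm (f (x + (0 + t) *\<^sub>R v) - f (x + 0 *\<^sub>R v) - t *\<^sub>R ?D x) / norm t) \<longlongrightarrow> 0) (at 0)"
      using line[of x 0] by (simp add: has_derivative_at)
    moreover have "filterlim h (at 0) sequentially"
      using LIMSEQ_inverse_real_of_nat h
      by (auto simp: filterlim_at h_def[abs_def] intro!: always_eventually)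
    ultimately have "(\<lambda>n. norm (f (x + (0 + h n) *\<^sub>R v) - f (x + 0 *\<^sub>R v) - h n *\<^sub>R ?D x) / norm (h n)) \<longlonglongrightarrow> 0"
      by (rule filterlim_compose)
    moreover have "norm (f (x + (0 + h n) *\<^sub>R v) - f (x + 0 *\<^sub>R v) - h n *\<^sub>R ?D x) / norm (h n)
        = norm (q n x - ?D x)" for n
    proof -
      have "q n x - ?D x = inverse (h n) *\<^sub>R (f (x + (0 + h n) *\<^sub>R v) - f (x + 0 *\<^sub>R v) - h n *\<^sub>R ?D x)"
        using h[of n] by (simp add: q_def add.commute scaleR_diff_right)
      then show ?thesis using h[of n] by (simp add: divide_inverse mult.commute)
    qed
    ultimately show ?thesis by (simp add: tendsto_norm_zero_iff LIM_zero_iff)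
  qed
  have "integral\<^sup>L lborel (q n) = 0" for n
  proof -
    have "integrable lborel (\<lambda>x. f (h n *\<^sub>R v + x))"
      using integrable_distr_eq[of "(+) (h n *\<^sub>R v)" lborel borel f] meas test_fun_integrable[OF f]
      by (simp add: lborel_distr_plus)
    then show ?thesis
      using test_fun_integrable[OF f] integral_translate[OF meas(1), of "h n *\<^sub>R v"]
      by (simp add: q_def[abs_def])
  qed
  moreover have "(\<lambda>n. integral\<^sup>L lborel (q n)) \<longlonglongrightarrow> integral\<^sup>L lborel ?D"
  proof (rule integral_dominated_convergence[where w="\<lambda>x. M * indicator (cball 0 (R + norm v)) x"])
    show "integrable lborel (\<lambda>x. M * indicator (cball 0 (R + norm v)) x)"
      using emeasure_lborel_cball_finite by (intro integrable_mult_right integrable_real_indicator) auto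
    show "q n \<in> borel_measurable lborel" for n
      using meas(1) unfolding q_def by measurable
  qed (use meas bound lim in auto)
  ultimately show ?thesis by (simp add: LIMSEQ_const_iff)
qed

text \<open>Horizontal fields are divergence free: the coefficient \<open>w\<close> of the vertical
  derivative is constant in the vertical direction and can be moved under that derivative. What
  remains is a sum of derivatives in fixed directions.\<close>

lemma integral_lie_deriv:
  fixes f :: "'m::finite heis \<Rightarrow> complex"
  assumes f: "f \<in> test_fun"
  shows "(\<integral>x. lie_deriv (horizontal e) f x \<partial>lborel) = 0"
proof -
  define w where "w p = complex_of_real (2 * Im (\<Sum>k\<in>UNIV. snd p $ k * cnj (e $ k)))" for p :: "'m heis"
  have Ckw: "Ck n w" for n unfolding w_def[abs_def] by (rule Ck_symplectic)
  have lin: "bounded_linear w"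
    unfolding w_def[abs_def]
    by (rule bounded_linear_compose[OF bounded_linear_of_real
        bounded_linear_compose[OF bounded_linear_symplectic bounded_linear_snd]])
  have fw: "(\<lambda>x. f x * w x) \<in> test_fun" by (rule test_fun_mult[OF f Ckw])
  have "frechet_derivative (\<lambda>x. f x * w x) (at p) (1, 0) = frechet_derivative f (at p) (1, 0) * w p" for p
  proof -
    have "((\<lambda>x. f x * w x) has_derivative (\<lambda>v. f p * w v + frechet_derivative f (at p) v * w p)) (at p)"
      by (intro has_derivative_mult test_fun_has_derivative f bounded_linear_imp_has_derivative lin)
    note D = frechet_derivative_at[OF this, symmetric]
    have "w (1, 0) = 0" by (simp add: w_def)
    then show ?thesis by (simp add: D)
  qed
  then have "lie_deriv (horizontal e) f = (\<lambda>p. frechet_derivative f (at p) (0, e)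
      + frechet_derivative (\<lambda>x. f x * w x) (at p) (1, 0))"
    by (simp only: lie_deriv_horizontal[OF f] w_def)
  then show ?thesis
    using test_fun_integrable[OF test_fun_frechet[OF f]] test_fun_integrable[OF test_fun_frechet[OF fw]]
      integral_frechet_derivative[OF f] integral_frechet_derivative[OF fw]
    by simp
qed

lemma integral_by_parts:
  assumes f: "f \<in> test_fun" and g: "g \<in> test_fun"
  shows "(\<integral>x. f x * lie_deriv (horizontal e) g x \<partial>lborel) = - (\<integral>x. lie_deriv (horizontal e) f x * g x \<partial>lborel)"
proof -
  have "(\<lambda>x. f x * g x) \<in> test_fun" "(\<lambda>x. f x * lie_deriv (horizontal e) g x) \<in> test_fun"
    "(\<lambda>x. lie_deriv (horizontal e) f x * g x) \<in> test_fun"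
    using assms by (auto intro!: test_fun_mult test_fun_Ck[OF g] test_fun_Ck[OF test_fun_lie_deriv[OF g]] test_fun_lie_deriv)
  then show ?thesis
    using integral_lie_deriv[of "\<lambda>x. f x * g x" e]
      Bochner_Integration.integral_add[of lborel "\<lambda>x. f x * lie_deriv (horizontal e) g x" "\<lambda>x. lie_deriv (horizontal e) f x * g x"]
    by (simp add: lie_deriv_mult[OF f g] eq_neg_iff_add_eq_0 test_fun_integrable)
qed

subsection \<open>Haar measure\<close>

lemma nn_integral_translate:
  fixes f :: "'a::euclidean_space \<Rightarrow> ennreal"
  assumes "f \<in> borel_measurable borel"
  shows "(\<integral>\<^sup>+x. f (c + x) \<partial>lborel) = (\<integral>\<^sup>+x. f x \<partial>lborel)"
  using nn_integral_distr[of "(+) c" lborel borel f] assms by (simp add: lborel_distr_plus)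

text \<open>For fixed z a left translation shifts t by a constant depending on z, and it then shifts
  z. Tonelli with t as the inner variable reduces the claim to two Euclidean translations.\<close>

lemma distr_heis_mult: "distr lborel borel (heis_mult a) = (lborel :: 'm::finite heis measure)"
proof (rule measure_eqI)
  fix A assume "A \<in> sets (distr lborel borel (heis_mult a))"
  then have A: "A \<in> sets borel" by simp
  have meas: "heis_mult a \<in> borel \<rightarrow>\<^sub>M borel"
    by (intro borel_measurable_continuous_onI continuous_heis_mult)
  define F :: "'m heis \<Rightarrow> ennreal" where "F = indicator A"
  have F: "F \<in> borel_measurable borel" using A by (simp add: F_def)
  have Fa: "(\<lambda>p. F (heis_mult a p)) \<in> borel_measurable borel" using F meas by measurable
  have fubini: "(\<integral>\<^sup>+p. G p \<partial>lborel) = (\<integral>\<^sup>+z. \<integral>\<^sup>+t. G (t, z) \<partial>lborel \<partial>lborel)"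
    if "G \<in> borel_measurable borel" for G :: "'m heis \<Rightarrow> ennreal"
  proof -
    have "G \<in> borel_measurable (lborel \<Otimes>\<^sub>M lborel)" using that by (simp add: lborel_prod)
    from lborel_pair.nn_integral_snd[OF this] show ?thesis by (simp add: lborel_prod)
  qed
  have slice: "(\<lambda>t. F (t, z)) \<in> borel_measurable borel" for z
  proof -
    have "(\<lambda>t. (t, z)) \<in> borel \<rightarrow>\<^sub>M (borel :: 'm heis measure)"
      by (intro borel_measurable_continuous_onI continuous_intros)
    then show ?thesis using F by measurable
  qed
  have "F \<in> borel_measurable (lborel \<Otimes>\<^sub>M lborel)" using F by (simp add: lborel_prod)
  then have slices: "(\<lambda>z. \<integral>\<^sup>+t. F (t, z) \<partial>lborel) \<in> borel_measurable borel"
    using lborel.borel_measurable_nn_integral[of "\<lambda>z t. F (t, z)" lborel]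
    by (simp add: case_prod_beta' measurable_split_conv)
  have "emeasure (distr lborel borel (heis_mult a)) A = (\<integral>\<^sup>+p. F p \<partial>distr lborel borel (heis_mult a))"
    using A by (simp add: F_def)
  also have "\<dots> = (\<integral>\<^sup>+p. F (heis_mult a p) \<partial>lborel)"
    using meas F by (subst nn_integral_distr) auto
  also have "\<dots> = (\<integral>\<^sup>+z. \<integral>\<^sup>+t. F (heis_mult a (t, z)) \<partial>lborel \<partial>lborel)"
    by (rule fubini[OF Fa])
  also have "\<dots> = (\<integral>\<^sup>+z. \<integral>\<^sup>+t. F (t, snd a + z) \<partial>lborel \<partial>lborel)"
  proof (rule nn_integral_cong)
    fix z :: "complex ^ 'm"
    define c where "c = fst a + 2 * Im (\<Sum>k\<in>UNIV. snd a $ k * cnj (z $ k))"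
    have "F (heis_mult a (t, z)) = F (c + t, snd a + z)" for t
      by (simp add: heis_mult_def c_def add_ac del: Im_sum)
    then show "(\<integral>\<^sup>+t. F (heis_mult a (t, z)) \<partial>lborel) = (\<integral>\<^sup>+t. F (t, snd a + z) \<partial>lborel)"
      using nn_integral_translate[OF slice[of "snd a + z"], of c] by simp
  qed
  also have "\<dots> = (\<integral>\<^sup>+z. \<integral>\<^sup>+t. F (t, z) \<partial>lborel \<partial>lborel)"
    by (rule nn_integral_translate[OF slices])
  also have "\<dots> = (\<integral>\<^sup>+p. F p \<partial>lborel)"
    by (rule fubini[OF F, symmetric])
  also have "\<dots> = emeasure lborel A" using A by (simp add: F_def)
  finally show "emeasure (distr lborel borel (heis_mult a)) A = emeasure lborel A" .
qed simp

section \<open>The sub-Laplacian on test functions\<close>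

definition second_deriv :: "complex ^ 'm \<Rightarrow> ('m::finite heis \<Rightarrow> complex) \<Rightarrow> 'm heis \<Rightarrow> complex" where
  "second_deriv e f = lie_deriv (horizontal e) (lie_deriv (horizontal e) f)"

text \<open>Written as a linear combination with explicit coefficients, so that the closure and linearity
  lemmas for finite sums apply to it literally.\<close>

definition sublap :: "('m::finite heis \<Rightarrow> complex) \<Rightarrow> 'm heis \<Rightarrow> complex" where
  "sublap f = (\<lambda>p. (\<Sum>k\<in>UNIV. (- 1) * second_deriv (axis k 1) f p)
    + (- 1) * (\<Sum>k\<in>UNIV. 1 * second_deriv (axis k \<i>) f p))"

text \<open>A term of type \<open>'m distr\<close> is an arbitrary functional on all functions, so
  linearity has to be stated, and is meaningful only on \<open>test_fun\<close>.\<close>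

definition test_linear :: "'m::finite distr \<Rightarrow> bool" where
  "test_linear \<Lambda> \<longleftrightarrow> (\<forall>f\<in>test_fun. \<forall>g\<in>test_fun. \<forall>c. \<Lambda> (\<lambda>x. f x + c * g x) = \<Lambda> f + c * \<Lambda> g)"

lemma test_linearD:
  "test_linear \<Lambda> \<Longrightarrow> f \<in> test_fun \<Longrightarrow> g \<in> test_fun \<Longrightarrow> \<Lambda> (\<lambda>x. f x + c * g x) = \<Lambda> f + c * \<Lambda> g"
  by (simp add: test_linear_def)

lemma test_linear_sum:
  assumes "test_linear \<Lambda>"
  shows "finite A \<Longrightarrow> (\<And>i. i \<in> A \<Longrightarrow> f i \<in> test_fun) \<Longrightarrow>
    \<Lambda> (\<lambda>x. \<Sum>i\<in>A. c i * f i x) = (\<Sum>i\<in>A. c i * \<Lambda> (f i))"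
proof (induction A rule: finite_induct)
  case empty
  \<comment> \<open>Two zero functions with c = 1 give \<Lambda> 0 = \<Lambda> 0 + \<Lambda> 0,
    hence \<Lambda> 0 = 0.\<close>
  show ?case using test_linearD[OF assms test_fun_zero test_fun_zero, of 1] by simp
next
  case (insert i A)
  have "\<Lambda> (\<lambda>x. (\<Sum>i\<in>A. c i * f i x) + c i * f i x) = \<Lambda> (\<lambda>x. \<Sum>i\<in>A. c i * f i x) + c i * \<Lambda> (f i)"
    using insert by (intro test_linearD[OF assms] test_fun_sum) auto
  then show ?case using insert by (simp add: add.commute)
qed

lemma test_fun_second_deriv: "f \<in> test_fun \<Longrightarrow> second_deriv e f \<in> test_fun"
  by (simp add: second_deriv_def test_fun_lie_deriv)

lemma test_fun_sublap: "f \<in> test_fun \<Longrightarrow> sublap f \<in> test_fun"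
  unfolding sublap_def by (intro test_fun_lincomb test_fun_sum test_fun_second_deriv) auto

lemma test_fun_sublap_funpow: "f \<in> test_fun \<Longrightarrow> (sublap ^^ n) f \<in> test_fun"
  by (induction n) (auto intro: test_fun_sublap)

lemma test_linear_sublap:
  assumes \<Lambda>: "test_linear \<Lambda>" and f: "f \<in> test_fun"
  shows "\<Lambda> (sublap f) = - (\<Sum>k\<in>UNIV. \<Lambda> (second_deriv (axis k 1) f))
    - (\<Sum>k\<in>UNIV. \<Lambda> (second_deriv (axis k \<i>) f))"
proof -
  have "\<Lambda> (sublap f) = \<Lambda> (\<lambda>p. \<Sum>k\<in>UNIV. (- 1) * second_deriv (axis k 1) f p)
      + (- 1) * \<Lambda> (\<lambda>p. \<Sum>k\<in>UNIV. 1 * second_deriv (axis k \<i>) f p)"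
    unfolding sublap_def by (intro test_linearD[OF \<Lambda>] test_fun_sum test_fun_second_deriv f) auto
  also have "\<Lambda> (\<lambda>p. \<Sum>k\<in>UNIV. (- 1) * second_deriv (axis k 1) f p)
      = (\<Sum>k\<in>UNIV. (- 1) * \<Lambda> (second_deriv (axis k 1) f))"
    by (intro test_linear_sum[OF \<Lambda>] test_fun_second_deriv f) auto
  also have "\<Lambda> (\<lambda>p. \<Sum>k\<in>UNIV. 1 * second_deriv (axis k \<i>) f p)
      = (\<Sum>k\<in>UNIV. 1 * \<Lambda> (second_deriv (axis k \<i>) f))"
    by (intro test_linear_sum[OF \<Lambda>] test_fun_second_deriv f) auto
  finally show ?thesis by (simp add: sum_negf)
qed

text \<open>Transposing a field twice cancels the signs, so D is its own transpose. Linearity is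
  what allows the sum inside \<open>sublap f\<close> to be taken out of \<Lambda>.\<close>

lemma distr_subLap_sublap:
  assumes "test_linear \<Lambda>" "f \<in> test_fun"
  shows "distr_subLap \<Lambda> f = \<Lambda> (sublap f)"
  unfolding test_linear_sublap[OF assms]
  by (simp add: distr_subLap_def distr_deriv_def X_field_horizontal Y_field_horizontal second_deriv_def)

lemma sublap_lincomb:
  assumes "f \<in> test_fun" "g \<in> test_fun"
  shows "sublap (\<lambda>x. f x + c * g x) = (\<lambda>p. sublap f p + c * sublap g p)"
  using assms
  by (simp add: sublap_def second_deriv_def lie_deriv_lincomb test_fun_lie_deriv sum.distrib
      sum_negf sum_subtractf sum_distrib_left[symmetric] algebra_simps)

text \<open>Both claims are proved together because the formula for the next power needs linearity
  of the current one.\<close>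

lemma test_linear_distr_subLap_funpow:
  assumes "test_linear \<Lambda>"
  shows "test_linear ((distr_subLap ^^ n) \<Lambda>)
    \<and> (\<forall>f\<in>test_fun. (distr_subLap ^^ n) \<Lambda> f = \<Lambda> ((sublap ^^ n) f))"
proof (induction n)
  case (Suc n)
  let ?\<Lambda> = "(distr_subLap ^^ n) \<Lambda>"
  have lin: "test_linear ?\<Lambda>" using Suc by simp
  then have eq: "distr_subLap ?\<Lambda> f = ?\<Lambda> (sublap f)" if "f \<in> test_fun" for f
    using distr_subLap_sublap that by blast
  have "test_linear (distr_subLap ?\<Lambda>)"
    using test_linearD[OF lin]
    by (simp add: test_linear_def eq sublap_lincomb test_fun_lincomb test_fun_sublap)
  moreover have "distr_subLap ?\<Lambda> f = \<Lambda> (sublap ((sublap ^^ n) f))" if "f \<in> test_fun" for f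
    using Suc that by (simp add: eq test_fun_sublap funpow_swap1[of sublap])
  ultimately show ?case by simp
qed (use assms in simp)

lemma sublap_cnj: "f \<in> test_fun \<Longrightarrow> sublap (\<lambda>x. cnj (f x)) = (\<lambda>p. cnj (sublap f p))"
  by (simp add: sublap_def second_deriv_def lie_deriv_cnj test_fun_lie_deriv)

lemma sublap_funpow_cnj:
  "f \<in> test_fun \<Longrightarrow> (sublap ^^ n) (\<lambda>x. cnj (f x)) = (\<lambda>p. cnj ((sublap ^^ n) f p))"
  by (induction n) (auto simp: sublap_cnj test_fun_sublap_funpow)

lemma sublap_translate:
  "f \<in> test_fun \<Longrightarrow> sublap (\<lambda>x. f (heis_mult a x)) = (\<lambda>p. sublap f (heis_mult a p))"
  by (simp add: sublap_def second_deriv_def lie_deriv_translate test_fun_lie_deriv)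

lemma sublap_funpow_translate:
  "f \<in> test_fun \<Longrightarrow> (sublap ^^ n) (\<lambda>x. f (heis_mult a x)) = (\<lambda>p. (sublap ^^ n) f (heis_mult a p))"
  by (induction n) (auto simp: sublap_translate test_fun_sublap_funpow)

lemma sublap_zero_outside:
  assumes "closed K" "\<And>x. x \<notin> K \<Longrightarrow> f x = 0" "x \<notin> K"
  shows "sublap f x = 0"
proof -
  have "second_deriv e f x = 0" for e
    unfolding second_deriv_def using assms by (intro lie_deriv_zero_outside[of K]) auto
  then show ?thesis by (simp add: sublap_def)
qed

lemma sublap_funpow_zero_outside:
  assumes "closed K" "\<And>x. x \<notin> K \<Longrightarrow> f x = 0"
  shows "x \<notin> K \<Longrightarrow> (sublap ^^ n) f x = 0"
  by (induction n arbitrary: x) (use assms in \<open>auto intro: sublap_zero_outside[of K]\<close>)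

section \<open>Square integrable functions\<close>

lemma L2_mult_integrable:
  assumes "f \<in> L2" "g \<in> L2"
  shows "integrable lborel (\<lambda>x. f x * g x)"
proof (rule Bochner_Integration.integrable_bound)
  show "integrable lborel (\<lambda>x. (norm (f x))\<^sup>2 + (norm (g x))\<^sup>2)"
    using assms by (simp add: L2_def)
  show "(\<lambda>x. f x * g x) \<in> borel_measurable lborel"
    using assms by (auto simp: L2_def)
  have "norm (f x * g x) \<le> (norm (f x))\<^sup>2 + (norm (g x))\<^sup>2" for x
    using sum_squares_bound[of "norm (f x)" "norm (g x)"] norm_ge_zero[of "f x * g x"]
    by (simp only: norm_mult)
  then show "AE x in lborel. norm (f x * g x) \<le> norm ((norm (f x))\<^sup>2 + (norm (g x))\<^sup>2)" by simp
qed

lemma L2_cnj: "f \<in> L2 \<Longrightarrow> (\<lambda>x. cnj (f x)) \<in> L2"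
proof -
  assume f: "f \<in> L2"
  have "cnj \<in> borel_measurable borel"
    by (intro borel_measurable_continuous_onI continuous_intros)
  then show ?thesis
    using f measurable_compose[of f borel borel cnj borel] by (auto simp: L2_def)
qed

lemma L2_lincomb_expand:
  assumes f: "f \<in> L2" and g: "g \<in> L2"
  shows "(\<lambda>x. f x + c * g x) \<in> L2"
    and "(\<integral>x. (norm (f x + c * g x))\<^sup>2 \<partial>lborel) = (\<integral>x. (norm (f x))\<^sup>2 \<partial>lborel)
      + 2 * Re (cnj c * (\<integral>x. f x * cnj (g x) \<partial>lborel)) + (norm c)\<^sup>2 * (\<integral>x. (norm (g x))\<^sup>2 \<partial>lborel)"
proof -
  have fg: "integrable lborel (\<lambda>x. f x * cnj (g x))"
    by (rule L2_mult_integrable[OF f L2_cnj[OF g]])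
  define R where "R x = Re (cnj c * (f x * cnj (g x)))" for x
  have expand: "(norm (f x + c * g x))\<^sup>2 = (norm (f x))\<^sup>2 + 2 * R x + (norm c)\<^sup>2 * (norm (g x))\<^sup>2" for x
    unfolding cmod_power2 R_def by (simp add: power2_eq_square algebra_simps)
  have int: "integrable lborel (\<lambda>x. (norm (f x))\<^sup>2)" "integrable lborel (\<lambda>x. (norm (g x))\<^sup>2)"
    "integrable lborel R"
    using f g integrable_Re[OF integrable_mult_right[OF fg, of "cnj c"]]
    by (auto simp: L2_def R_def[abs_def] simp del: complex_cnj_mult)
  then have "integrable lborel (\<lambda>x. (norm (f x + c * g x))\<^sup>2)"
    unfolding expand by (intro Bochner_Integration.integrable_add integrable_mult_right)
  then show "(\<lambda>x. f x + c * g x) \<in> L2"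
    using f g by (auto simp: L2_def)
  have "integral\<^sup>L lborel R = Re (cnj c * (\<integral>x. f x * cnj (g x) \<partial>lborel))"
    unfolding R_def[abs_def] using fg by (simp only: integral_Re integrable_mult_right integral_mult_right_zero)
  then show "(\<integral>x. (norm (f x + c * g x))\<^sup>2 \<partial>lborel) = (\<integral>x. (norm (f x))\<^sup>2 \<partial>lborel)
      + 2 * Re (cnj c * (\<integral>x. f x * cnj (g x) \<partial>lborel)) + (norm c)\<^sup>2 * (\<integral>x. (norm (g x))\<^sup>2 \<partial>lborel)"
    unfolding expand using int by simp
qed

text \<open>With \<open>m = 0\<close> this is a form of the Cauchy-Schwarz inequality; with \<open>m\<close> the squared norm of
  \<open>f\<close> it says that a minimizer on a line is orthogonal to its direction.\<close>

lemma L2_inner_bound: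
  assumes f: "f \<in> L2" and g: "g \<in> L2"
    and m: "\<And>c. m \<le> (\<integral>x. (norm (f x + c * g x))\<^sup>2 \<partial>lborel)"
  shows "(norm (\<integral>x. f x * cnj (g x) \<partial>lborel))\<^sup>2
    \<le> ((\<integral>x. (norm (g x))\<^sup>2 \<partial>lborel) + 1) * ((\<integral>x. (norm (f x))\<^sup>2 \<partial>lborel) - m)"
proof -
  define I where "I = (\<integral>x. f x * cnj (g x) \<partial>lborel)"
  define G where "G = (\<integral>x. (norm (g x))\<^sup>2 \<partial>lborel)"
  define F where "F = (\<integral>x. (norm (f x))\<^sup>2 \<partial>lborel)"
  \<comment> \<open>The optimal c in the quadratic polynomial is -I/G; G + 1 in place of G avoids
    division by 0 when \<open>g\<close> vanishes almost everywhere, and still gives t * G \<le>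
    1.\<close>
  define t where "t = inverse (G + 1)"
  have G: "0 \<le> G" by (simp add: G_def)
  have "cnj (- of_real t * I) * I = - of_real (t * (norm I)\<^sup>2)"
    using complex_norm_square[of I] by (simp add: mult_ac)
  then have "m \<le> F - 2 * (t * (norm I)\<^sup>2) + (t * norm I)\<^sup>2 * G"
    using m[of "- of_real t * I"] L2_lincomb_expand(2)[OF f g, of "- of_real t * I"] G
    by (simp add: I_def[symmetric] G_def[symmetric] F_def[symmetric] t_def norm_mult norm_inverse
        del: of_real_mult of_real_power)
  also have "\<dots> = F - t * (norm I)\<^sup>2 * (2 - t * G)" by (simp add: power2_eq_square algebra_simps)
  also have "\<dots> \<le> F - t * (norm I)\<^sup>2 * 1"
    using G by (intro diff_left_mono mult_left_mono) (auto simp: t_def field_simps)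
  finally have "t * (norm I)\<^sup>2 \<le> F - m" by simp
  then have "(G + 1) * (t * (norm I)\<^sup>2) \<le> (G + 1) * (F - m)"
    using G by (intro mult_left_mono) auto
  moreover have "(G + 1) * (t * (norm I)\<^sup>2) = (norm I)\<^sup>2" using G by (simp add: t_def)
  ultimately show ?thesis by (simp only: I_def F_def G_def)
qed

section \<open>Powers of the sub-Laplacian\<close>

lemma distr_of_lincomb:
  assumes "f \<in> L2" "g \<in> L2" "\<phi> \<in> test_fun"
  shows "distr_of (\<lambda>x. f x + c * g x) \<phi> = distr_of f \<phi> + c * distr_of g \<phi>"
  using L2_mult_integrable[OF assms(1) test_fun_L2[OF assms(3)]]
    L2_mult_integrable[OF assms(2) test_fun_L2[OF assms(3)]]
  by (simp add: distr_of_def distrib_right mult.assoc)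

lemma test_linear_distr_of:
  assumes "f \<in> L2"
  shows "test_linear (distr_of f)"
  unfolding test_linear_def
proof (intro ballI allI)
  fix \<phi> \<psi> :: "'a heis \<Rightarrow> complex" and c
  assume "\<phi> \<in> test_fun" "\<psi> \<in> test_fun"
  then show "distr_of f (\<lambda>x. \<phi> x + c * \<psi> x) = distr_of f \<phi> + c * distr_of f \<psi>"
    using L2_mult_integrable[OF assms test_fun_L2] by (simp add: distr_of_def distrib_left mult.left_commute[of _ c])
qed

lemma distr_of_commute: "distr_of f g = distr_of g f"
  by (simp add: distr_of_def mult.commute)

text \<open>Each square of a field takes two integrations by parts, whose signs cancel.\<close>

lemma distr_of_sublap:
  assumes f: "f \<in> test_fun" and g: "g \<in> test_fun"
  shows "distr_of f (sublap g) = distr_of (sublap f) g"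
proof -
  have "distr_of f (second_deriv e g) = distr_of g (second_deriv e f)" for e
    using integral_by_parts[OF f test_fun_lie_deriv[OF g]] integral_by_parts[OF test_fun_lie_deriv[OF f] g]
    by (simp add: distr_of_def second_deriv_def mult.commute)
  then have "distr_of f (sublap g) = distr_of g (sublap f)"
    using f g by (simp add: test_linear_sublap test_linear_distr_of test_fun_L2)
  then show ?thesis by (simp add: distr_of_commute)
qed

lemma subLap_iff:
  "subLap f g \<longleftrightarrow> f \<in> L2 \<and> g \<in> L2 \<and> (\<forall>\<phi>\<in>test_fun. distr_of f (sublap \<phi>) = distr_of g \<phi>)"
proof (cases "f \<in> L2")
  case True
  then show ?thesis
    by (auto simp: subLap_def distr_subLap_sublap test_linear_distr_of)
qed (simp add: subLap_def)

lemma subLap_test_fun: "f \<in> test_fun \<Longrightarrow> subLap f (sublap f)"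
  by (simp add: subLap_iff test_fun_L2 test_fun_sublap distr_of_sublap)

lemma subLap_funpow_test_fun: "f \<in> test_fun \<Longrightarrow> (subLap ^^ k) f ((sublap ^^ k) f)"
  by (induction k) (auto intro: subLap_test_fun test_fun_sublap_funpow)

lemma I_plus_subLap_funpow_test_fun:
  "f \<in> test_fun \<Longrightarrow> \<exists>h. (I_plus_subLap ^^ k) f h"
proof (induction k arbitrary: f)
  case (Suc k)
  have "(\<lambda>x. f x + 1 * sublap f x) \<in> test_fun"
    by (intro test_fun_lincomb test_fun_sublap Suc.prems)
  then obtain h where "(I_plus_subLap ^^ k) (\<lambda>x. f x + sublap f x) h" using Suc.IH by auto
  moreover have "I_plus_subLap f (\<lambda>x. f x + sublap f x)"
    using subLap_test_fun[OF Suc.prems] by (auto simp: I_plus_subLap_def)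
  ultimately show ?case using relpowp_Suc_I2 by metis
qed auto

text \<open>Operators are graphs here, so linearity of a power is a statement about the relation; it
  is used for D and for I + D.\<close>

lemma relpowp_lincomb:
  fixes R :: "('a \<Rightarrow> complex) \<Rightarrow> ('a \<Rightarrow> complex) \<Rightarrow> bool"
  assumes "\<And>f g f' g'. R f g \<Longrightarrow> R f' g' \<Longrightarrow> R (\<lambda>x. f x + c * f' x) (\<lambda>x. g x + c * g' x)"
  shows "(R ^^ k) f g \<Longrightarrow> (R ^^ k) f' g' \<Longrightarrow> (R ^^ k) (\<lambda>x. f x + c * f' x) (\<lambda>x. g x + c * g' x)"
proof (induction k arbitrary: g g')
  case (Suc k)
  then show ?case using assms by (elim relpowp_Suc_E) (blast intro: relpowp_Suc_I)
qed simp

lemma subLap_lincomb: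
  "subLap f g \<Longrightarrow> subLap f' g' \<Longrightarrow> subLap (\<lambda>x. f x + c * f' x) (\<lambda>x. g x + c * g' x)"
  by (simp add: subLap_iff L2_lincomb_expand(1) distr_of_lincomb test_fun_sublap)

lemma I_plus_subLap_lincomb:
  assumes "I_plus_subLap f g" "I_plus_subLap f' g'"
  shows "I_plus_subLap (\<lambda>x. f x + c * f' x) (\<lambda>x. g x + c * g' x)"
proof -
  obtain d d' where d: "subLap f d" "g = (\<lambda>x. f x + d x)" "subLap f' d'" "g' = (\<lambda>x. f' x + d' x)"
    using assms by (auto simp: I_plus_subLap_def)
  have "subLap (\<lambda>x. f x + c * f' x) (\<lambda>x. d x + c * d' x)" by (intro subLap_lincomb d)
  moreover have "(\<lambda>x. g x + c * g' x) = (\<lambda>x. (f x + c * f' x) + (d x + c * d' x))"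
    by (simp add: d algebra_simps)
  ultimately show ?thesis unfolding I_plus_subLap_def by blast
qed

lemma distr_of_subLap_funpow:
  "(subLap ^^ k) f g \<Longrightarrow> \<phi> \<in> test_fun \<Longrightarrow> distr_of f ((sublap ^^ k) \<phi>) = distr_of g \<phi>"
proof (induction k arbitrary: f)
  case (Suc k)
  obtain f1 where f1: "subLap f f1" "(subLap ^^ k) f1 g" using relpowp_Suc_D2[OF Suc.prems(1)] by blast
  have "distr_of f ((sublap ^^ Suc k) \<phi>) = distr_of f1 ((sublap ^^ k) \<phi>)"
    using f1(1) test_fun_sublap_funpow[OF Suc.prems(2)] by (simp add: subLap_iff)
  also have "\<dots> = distr_of g \<phi>" using Suc f1(2) by blast
  finally show ?case .
qed simp

section \<open>The lattice\<close>

lemma norm_fst_snd_le: "norm (fst x) \<le> norm x" "norm (snd x) \<le> norm x"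
  by (metis norm_fst_le norm_snd_le prod.collapse)+

text \<open>The coordinates are integer multiples of a spacing, 2^j horizontally and 2^(2j)
  vertically. The two parts are separate because the twist in the group law allows t to be compared
  only once the z components agree.\<close>

lemma heis_lattice_separated:
  assumes "p \<in> heis_lattice j" "q \<in> heis_lattice j"
  shows "norm (snd p - snd q) < 2 powi j \<Longrightarrow> snd p = snd q"
    and "\<bar>fst p - fst q\<bar> < 2 powi (2 * j) \<Longrightarrow> fst p = fst q"
proof -
  obtain a b c where p: "p = (2 powi (2 * j) * of_int a, \<chi> k. 2 powi j * Complex (of_int (b k)) (of_int (c k)))"
    using assms(1) by (auto simp: heis_lattice_eq)
  obtain a' b' c' where q: "q = (2 powi (2 * j) * of_int a', \<chi> k. 2 powi j * Complex (of_int (b' k)) (of_int (c' k)))"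
    using assms(2) by (auto simp: heis_lattice_eq)
  have int0: "m = n" if "d > 0" "\<bar>d * of_int m - d * of_int n\<bar> < d" for d :: real and m n :: int
  proof -
    have "d * \<bar>of_int (m - n)\<bar> = \<bar>d * of_int m - d * of_int n\<bar>"
      using that(1) by (simp add: right_diff_distrib[symmetric] abs_mult)
    then have "d * \<bar>of_int (m - n)\<bar> < d * 1" using that(2) by simp
    then have "\<bar>real_of_int (m - n)\<bar> < 1" using that(1) by (subst (asm) mult_less_cancel_left_pos)
    then show ?thesis by linarith
  qed
  have re: "Re (2 powi j * z) = 2 powi j * Re z" "Im (2 powi j * z) = 2 powi j * Im z" for z
  proof -
    have "Re (of_real c * z) = c * Re z" "Im (of_real c * z) = c * Im z" for c by simp_all
    from this[of "2 powi j"]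
    show "Re (2 powi j * z) = 2 powi j * Re z" "Im (2 powi j * z) = 2 powi j * Im z" by simp_all
  qed
  show "snd p = snd q" if less: "norm (snd p - snd q) < 2 powi j"
  proof -
    have "b k = b' k \<and> c k = c' k" for k
    proof -
      have *: "norm (snd p $ k - snd q $ k) < 2 powi j"
        using Finite_Cartesian_Product.norm_nth_le[of "snd p - snd q" k] less by simp
      have "\<bar>Re (snd p $ k - snd q $ k)\<bar> < 2 powi j" "\<bar>Im (snd p $ k - snd q $ k)\<bar> < 2 powi j"
        using abs_Re_le_cmod abs_Im_le_cmod * order_le_less_trans by blast+
      then show ?thesis
        by (auto simp: p q re simp del: times_complex.simps intro!: int0[of "2 powi j"])
    qed
    then show ?thesis by (simp add: p q)
  qed
  show "fst p = fst q" if "\<bar>fst p - fst q\<bar> < 2 powi (2 * j)"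
    using int0[of "2 powi (2 * j)" a a'] that by (simp add: p q)
qed

text \<open>Two points of a ball of this radius differ by at most half of either lattice spacing,
  hence strictly less than one spacing.\<close>

definition lattice_radius :: "int \<Rightarrow> real" where
  "lattice_radius j = min (2 powi j) (2 powi (2 * j)) / 4"

lemma lattice_radius: "0 < lattice_radius j" "4 * lattice_radius j \<le> 2 powi j"
  "4 * lattice_radius j \<le> 2 powi (2 * j)"
  by (auto simp: lattice_radius_def)

text \<open>The components in \<open>complex ^ 'm\<close> agree first; then the twist in the group law is the same on
  both sides and cancels in the real component.\<close>

lemma heis_lattice_translates_disjoint:
  assumes "p \<in> heis_lattice j" "q \<in> heis_lattice j"
    and u: "norm u \<le> lattice_radius j" and v: "norm v \<le> lattice_radius j"
    and eq: "heis_mult p u = heis_mult q v"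
  shows "p = q"
proof -
  note r = lattice_radius[of j]
  have diff: "norm (v - u) \<le> 2 * lattice_radius j"
    using norm_triangle_ineq4[of v u] u v by simp
  have sd: "snd p - snd q = snd (v - u)"
    using arg_cong[OF eq, of snd] by (simp add: heis_mult_def algebra_simps)
  have "norm (snd p - snd q) < 2 powi j"
    unfolding sd using diff r norm_fst_snd_le(2)[of "v - u"] by linarith
  then have z: "snd p = snd q" using heis_lattice_separated(1)[OF assms(1,2)] by simp
  then have "snd u = snd v" using arg_cong[OF eq, of snd] by (simp add: heis_mult_def)
  then have "fst p - fst q = fst (v - u)"
    using arg_cong[OF eq, of fst] z by (simp add: heis_mult_def)
  then have "\<bar>fst p - fst q\<bar> < 2 powi (2 * j)"
    using diff r norm_fst_snd_le(1)[of "v - u"] by simp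
  then have "fst p = fst q" using heis_lattice_separated(2)[OF assms(1,2)] by simp
  with z show ?thesis by (simp add: prod_eq_iff)
qed

text \<open>The Euclidean norm dominates both components, so the lattice is uniformly discrete.
  Consequently the sum of Dirac measures is finite on each test function.\<close>

lemma finite_heis_lattice_Int:
  assumes "bounded K"
  shows "finite (heis_lattice j \<inter> K :: 'm::finite heis set)"
proof -
  note r = lattice_radius[of j]
  have sep: "p = q" if "p \<in> heis_lattice j" "q \<in> heis_lattice j" "dist p q < lattice_radius j" for p q :: "'m heis"
  proof (rule prod_eqI)
    have "norm (p - q) < 2 powi j" "norm (p - q) < 2 powi (2 * j)"
      using that(3) r by (auto simp: dist_norm)
    then show "snd p = snd q" and "fst p = fst q"
      using heis_lattice_separated[OF that(1,2)] norm_fst_snd_le[of "p - q"] by auto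
  qed
  have "uniform_discrete (heis_lattice j \<inter> K)"
    unfolding uniform_discrete_def using r(1) sep by blast
  then show ?thesis
    using assms uniform_discrete_finite_iff bounded_Int by blast
qed

text \<open>The function \<open>flat 0\<close> of r^2 - |x|^2 vanishes outside the ball and equals
  exp(-1/r^2) > 0 at the origin, so it can be normalized.\<close>

lemma bump_exists:
  fixes r :: real
  assumes "0 < r"
  obtains \<Psi> :: "'m::finite heis \<Rightarrow> complex"
  where "\<Psi> \<in> test_fun" "\<Psi> 0 = 1" "\<And>x. x \<notin> cball 0 r \<Longrightarrow> \<Psi> x = 0"
proof
  define \<Psi> :: "'m heis \<Rightarrow> complex" where "\<Psi> x = of_real (flat 0 (r\<^sup>2 - x \<bullet> x)) * (1 / of_real (flat 0 (r\<^sup>2)))" for x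
  show zero: "\<Psi> x = 0" if "x \<notin> cball 0 r" for x
  proof -
    have "r\<^sup>2 \<le> x \<bullet> x" using that assms power_mono[of r "norm x" 2] by (simp add: dot_square_norm)
    then show ?thesis by (simp add: \<Psi>_def flat_def)
  qed
  show "\<Psi> \<in> test_fun"
  proof (rule test_funI[of _ "cball 0 r"])
    show "Ck n \<Psi>" for n
      unfolding \<Psi>_def[abs_def]
      by (intro Ck_mult Ck_const Ck_linear_comp[OF bounded_linear_of_real] Ck_flat_paraboloid)
  qed (use zero in auto)
  show "\<Psi> 0 = 1" using assms by (simp add: \<Psi>_def flat_def)
qed

section \<open>Orthogonality of the spline\<close>

lemma interpolants_perturb:
  assumes s: "s \<in> interpolants k j y" and \<phi>: "\<phi> \<in> test_fun" "\<And>x. x \<in> heis_lattice j \<Longrightarrow> \<phi> x = 0"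
  shows "(\<lambda>x. s x + c * \<phi> x) \<in> interpolants k j y"
proof -
  obtain h where "(I_plus_subLap ^^ k) s h"
    using s by (auto simp: interpolants_def sobolev_even_def)
  moreover obtain h' where "(I_plus_subLap ^^ k) \<phi> h'"
    using I_plus_subLap_funpow_test_fun[OF \<phi>(1)] by blast
  ultimately have "(I_plus_subLap ^^ k) (\<lambda>x. s x + c * \<phi> x) (\<lambda>x. h x + c * h' x)"
    by (intro relpowp_lincomb I_plus_subLap_lincomb)
  then show ?thesis
    using s \<phi>(2) by (auto simp: interpolants_def sobolev_even_def intro!: continuous_intros test_fun_continuous[OF \<phi>(1)])
qed

lemma spline_orthogonal:
  assumes s: "s \<in> interpolants k j y" and g: "(subLap ^^ k) s g" "g \<in> L2"
    and min: "\<And>u h. u \<in> interpolants k j y \<Longrightarrow> (subLap ^^ k) u h \<Longrightarrow> L2_norm g \<le> L2_norm h"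
    and \<phi>: "\<phi> \<in> test_fun" "\<And>x. x \<in> heis_lattice j \<Longrightarrow> \<phi> x = 0"
  shows "distr_of g ((sublap ^^ k) \<phi>) = 0"
proof -
  \<comment> \<open>The conjugate turns the Hermitian inner product of the variational argument into
    the bilinear pairing of the claim.\<close>
  let ?\<phi> = "\<lambda>x. cnj (\<phi> x)"
  let ?h = "(sublap ^^ k) ?\<phi>"
  have \<phi>': "?\<phi> \<in> test_fun" "\<And>x. x \<in> heis_lattice j \<Longrightarrow> ?\<phi> x = 0"
    using \<phi> by (auto simp: test_fun_cnj)
  have h: "?h \<in> L2" by (intro test_fun_L2 test_fun_sublap_funpow \<phi>')
  have "(\<integral>x. (norm (g x))\<^sup>2 \<partial>lborel) \<le> (\<integral>x. (norm (g x + c * ?h x))\<^sup>2 \<partial>lborel)" for c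
  proof -
    have "(subLap ^^ k) (\<lambda>x. s x + c * ?\<phi> x) (\<lambda>x. g x + c * ?h x)"
      by (intro relpowp_lincomb subLap_lincomb g(1) subLap_funpow_test_fun \<phi>'(1))
    then have "L2_norm g \<le> L2_norm (\<lambda>x. g x + c * ?h x)"
      using min interpolants_perturb[OF s \<phi>'] by blast
    then show ?thesis by (simp add: L2_norm_def)
  qed
  from L2_inner_bound[OF g(2) h this]
  have "(\<integral>x. g x * cnj (?h x) \<partial>lborel) = 0" by simp
  then show ?thesis
    by (simp add: distr_of_def sublap_funpow_cnj[OF \<phi>(1)])
qed

section \<open>Square summability of the coefficients\<close>

lemma ell2_translates:
  fixes g h :: "'m::finite heis \<Rightarrow> complex"
  assumes g: "g \<in> L2" and h: "h \<in> test_fun" "\<And>x. x \<notin> cball 0 (lattice_radius j) \<Longrightarrow> h x = 0"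
  shows "(\<lambda>p. distr_of g (\<lambda>x. h (heis_mult (- p) x))) \<in> ell2_on (heis_lattice j)"
proof -
  define B where "B p = heis_mult (- p) -` cball 0 (lattice_radius j)" for p :: "'m heis"
  define \<alpha> where "\<alpha> p = distr_of g (\<lambda>x. h (heis_mult (- p) x))" for p
  define H where "H = (\<integral>x. (norm (h x))\<^sup>2 \<partial>lborel)"
  have B: "B p \<in> sets borel" for p
    unfolding B_def by (intro borel_closed closed_vimage closed_cball continuous_heis_mult)
  have gint: "integrable lborel (\<lambda>x. (norm (g x))\<^sup>2)" using g by (simp add: L2_def)
  have ind: "(norm (indicator (B p) x * g x))\<^sup>2 = indicator (B p) x * (norm (g x))\<^sup>2" for p x
    by (simp add: indicator_def)
  have intB: "integrable lborel (\<lambda>x. indicator (B p) x * (norm (g x))\<^sup>2)" for p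
    using integrable_mult_indicator[OF _ gint, of "B p"] B by simp
  \<comment> \<open>Cutting \<open>g\<close> off to \<open>B p\<close> leaves the pairing unchanged
    and makes Cauchy-Schwarz see only the mass of \<open>g\<close> there.\<close>
  have bound: "(norm (\<alpha> p))\<^sup>2 \<le> (H + 1) * (\<integral>x. indicator (B p) x * (norm (g x))\<^sup>2 \<partial>lborel)" for p
  proof -
    let ?h = "\<lambda>x. h (heis_mult (- p) x)"
    have f: "(\<lambda>x. indicator (B p) x * g x) \<in> L2"
      using g B[of p] intB[of p] by (auto simp: L2_def ind intro!: borel_measurable_times borel_measurable_indicator)
    have h': "(\<lambda>x. cnj (?h x)) \<in> L2"
      by (intro test_fun_L2 test_fun_cnj test_fun_translate h)
    \<comment> \<open>Invariance of the measure makes this constant independent of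
      \<open>p\<close>.\<close>
    have "(\<integral>x. (norm (?h x))\<^sup>2 \<partial>lborel) = (\<integral>x. (norm (h x))\<^sup>2 \<partial>distr lborel borel (heis_mult (- p)))"
      using borel_measurable_continuous_onI[OF test_fun_continuous[OF h(1)]]
        borel_measurable_continuous_onI[OF continuous_heis_mult[of UNIV "- p"]]
      by (subst integral_distr) auto
    then have "(\<integral>x. (norm (?h x))\<^sup>2 \<partial>lborel) = H" by (simp add: distr_heis_mult H_def)
    moreover have "(\<integral>x. indicator (B p) x * g x * ?h x \<partial>lborel) = \<alpha> p"
      unfolding \<alpha>_def distr_of_def
    proof (rule Bochner_Integration.integral_cong[OF refl])
      show "indicator (B p) x * g x * ?h x = g x * ?h x" for x
        using h(2)[of "heis_mult (- p) x"] by (auto simp: B_def indicator_def)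
    qed
    ultimately show ?thesis
      using L2_inner_bound[OF f h', of 0] by (simp add: ind)
  qed
  have "(\<Sum>p\<in>F. (norm (\<alpha> p))\<^sup>2) \<le> (H + 1) * (\<integral>x. (norm (g x))\<^sup>2 \<partial>lborel)"
    if F: "F \<subseteq> heis_lattice j" "finite F" for F
  proof -
    \<comment> \<open>The translated balls are disjoint, so at most one summand is nonzero.\<close>
    have disj: "(\<Sum>p\<in>F. indicator (B p) x * (norm (g x))\<^sup>2) \<le> (norm (g x))\<^sup>2" for x
    proof (cases "\<exists>p\<in>F. x \<in> B p")
      case True
      then obtain p where p: "p \<in> F" "x \<in> B p" by blast
      have "x \<notin> B q" if "q \<in> F" "q \<noteq> p" for q
        using heis_lattice_translates_disjoint[of p j q "heis_mult (- p) x" "heis_mult (- q) x"]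
          p that F by (auto simp: B_def heis_mult_uminus)
      then have "(\<Sum>q\<in>F. indicator (B q) x * (norm (g x))\<^sup>2) = (\<Sum>q\<in>F. if q = p then (norm (g x))\<^sup>2 else 0)"
        using p by (intro sum.cong) (auto simp: indicator_def)
      also have "\<dots> = (norm (g x))\<^sup>2" using p F by simp
      finally show ?thesis by simp
    next
      case False
      then have "(\<Sum>p\<in>F. indicator (B p) x * (norm (g x))\<^sup>2) = 0"
        by (intro sum.neutral) auto
      then show ?thesis by simp
    qed
    have "(\<Sum>p\<in>F. (norm (\<alpha> p))\<^sup>2) \<le> (\<Sum>p\<in>F. (H + 1) * (\<integral>x. indicator (B p) x * (norm (g x))\<^sup>2 \<partial>lborel))"
      by (intro sum_mono bound)
    also have "\<dots> = (H + 1) * (\<integral>x. (\<Sum>p\<in>F. indicator (B p) x * (norm (g x))\<^sup>2) \<partial>lborel)"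
      using intB by (simp add: sum_distrib_left[symmetric])
    also have "\<dots> \<le> (H + 1) * (\<integral>x. (norm (g x))\<^sup>2 \<partial>lborel)"
      using disj intB gint by (intro mult_left_mono integral_mono) (auto simp: H_def)
    finally show ?thesis .
  qed
  then have "(\<lambda>p. (norm (\<alpha> p))\<^sup>2) summable_on heis_lattice j"
    by (intro nonneg_bdd_above_summable_on) (auto simp: bdd_above_def)
  then show ?thesis by (simp add: ell2_on_def \<alpha>_def)
qed

section \<open>Expansion of D^(2k) s in Dirac measures\<close>

theorem mainTheorem3:
  fixes k :: nat and j :: int and y s :: "'m::finite heis \<Rightarrow> complex"
  assumes "real k > real (hom_dim TYPE('m)) / 4"
    and "y \<in> ell2_on (heis_lattice j)"
    and "is_spline k j y s"
  shows "\<exists>\<alpha> \<in> ell2_on (heis_lattice j). \<forall>\<phi>\<in>test_fun.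
    ((\<lambda>x. \<alpha> x * dirac x \<phi>) has_sum (distr_subLap ^^ (2 * k)) (distr_of s) \<phi>) (heis_lattice j)"
proof -
  let ?r = "lattice_radius j"
  obtain g where s: "s \<in> interpolants k j y" and g: "(subLap ^^ k) s g"
    and min: "\<And>u h. u \<in> interpolants k j y \<Longrightarrow> (subLap ^^ k) u h \<Longrightarrow> L2_norm g \<le> L2_norm h"
    using assms(3) unfolding is_spline_def by blast
  \<comment> \<open>The zeroth relational power would say nothing about L2; from k \<ge> 1 the first
    step gives it for \<open>s\<close> and the last step for \<open>g\<close>.\<close>
  obtain n where n: "k = Suc n" using assms(1) by (cases k) auto
  have sL2: "s \<in> L2" using g relpowp_Suc_D2[of n subLap s g] by (auto simp: n subLap_def)
  have gL2: "g \<in> L2" using g relpowp_Suc_E[of n subLap s g] by (metis n subLap_def)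
  define M where "M = (distr_subLap ^^ k) (distr_of g)"
  have lin: "test_linear M" and M: "\<And>\<phi>. \<phi> \<in> test_fun \<Longrightarrow> M \<phi> = distr_of g ((sublap ^^ k) \<phi>)"
    using test_linear_distr_subLap_funpow[OF test_linear_distr_of[OF gL2], of k] by (auto simp: M_def)
  have orth: "M \<phi> = 0" if "\<phi> \<in> test_fun" "\<And>x. x \<in> heis_lattice j \<Longrightarrow> \<phi> x = 0" for \<phi>
    using spline_orthogonal[OF s g gL2 min that] M[OF that(1)] by simp
  have D2k: "(distr_subLap ^^ (2 * k)) (distr_of s) \<phi> = M \<phi>" if \<phi>: "\<phi> \<in> test_fun" for \<phi>
  proof -
    have "(distr_subLap ^^ (2 * k)) (distr_of s) \<phi> = distr_of s ((sublap ^^ k) ((sublap ^^ k) \<phi>))"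
      using test_linear_distr_subLap_funpow[OF test_linear_distr_of[OF sL2], of "2 * k"] \<phi>
      by (simp add: mult_2 funpow_add)
    also have "\<dots> = M \<phi>"
      by (simp add: M \<phi> distr_of_subLap_funpow[OF g] test_fun_sublap_funpow)
    finally show ?thesis .
  qed
  obtain \<Psi> :: "'m heis \<Rightarrow> complex"
    where \<Psi>: "\<Psi> \<in> test_fun" "\<Psi> 0 = 1" "\<And>x. x \<notin> cball 0 ?r \<Longrightarrow> \<Psi> x = 0"
    using bump_exists[OF lattice_radius(1)] by metis
  define \<psi> where "\<psi> p x = \<Psi> (heis_mult (- p) x)" for p x
  have \<psi>: "\<psi> p \<in> test_fun" for p
    unfolding \<psi>_def[abs_def] by (rule test_fun_translate[OF \<Psi>(1)])
  have \<psi>_same: "\<psi> p p = 1" for p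
    using heis_mult_uminus(1)[of p 0] \<Psi>(2) by (simp add: \<psi>_def heis_mult_def)
  \<comment> \<open>If the bump at \<open>p\<close> were nonzero at \<open>q\<close>, then
    \<open>q\<close> would lie in the balls translated to \<open>p\<close> and to \<open>q\<close>,
    the latter as its centre.\<close>
  have \<psi>_diff: "\<psi> p q = 0" if "p \<in> heis_lattice j" "q \<in> heis_lattice j" "p \<noteq> q" for p q
  proof (rule ccontr)
    assume "\<psi> p q \<noteq> 0"
    then have "norm (heis_mult (- p) q) \<le> ?r" using \<Psi>(3)[of "heis_mult (- p) q"] by (auto simp: \<psi>_def)
    then show False
      using heis_lattice_translates_disjoint[of p j q "heis_mult (- p) q" 0] that lattice_radius(1)[of j]
      by (simp add: heis_mult_uminus) (simp add: heis_mult_def)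
  qed
  define \<alpha> where "\<alpha> p = M (\<psi> p)" for p
  have "\<alpha> = (\<lambda>p. distr_of g (\<lambda>x. (sublap ^^ k) \<Psi> (heis_mult (- p) x)))"
    using \<psi> by (simp add: \<alpha>_def M \<psi>_def[abs_def] sublap_funpow_translate[OF \<Psi>(1)] fun_eq_iff)
  then have "\<alpha> \<in> ell2_on (heis_lattice j)"
    using ell2_translates[OF gL2 test_fun_sublap_funpow[OF \<Psi>(1)], of j k]
      sublap_funpow_zero_outside[of "cball 0 ?r" \<Psi> _ k] \<Psi>(3) by simp
  moreover have "((\<lambda>x. \<alpha> x * dirac x \<phi>) has_sum (distr_subLap ^^ (2 * k)) (distr_of s) \<phi>) (heis_lattice j)"
    if \<phi>: "\<phi> \<in> test_fun" for \<phi>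
  proof -
    obtain K where K: "compact K" "\<And>x. x \<notin> K \<Longrightarrow> \<phi> x = 0" using test_fun_support[OF \<phi>] by metis
    \<comment> \<open>Outside \<open>F\<close> the lattice values of \<phi> are 0, so a finite
      combination of bumps reproduces \<phi> on the whole lattice.\<close>
    define F where "F = heis_lattice j \<inter> K"
    have F: "finite F" unfolding F_def by (rule finite_heis_lattice_Int[OF compact_imp_bounded[OF K(1)]])
    let ?P = "\<lambda>x. \<Sum>p\<in>F. \<phi> p * \<psi> p x"
    have P: "?P \<in> test_fun" by (intro test_fun_sum F \<psi>)
    have "M (\<lambda>x. \<phi> x + (- 1) * ?P x) = 0"
    proof (rule orth)
      show "(\<lambda>x. \<phi> x + (- 1) * ?P x) \<in> test_fun" by (intro test_fun_lincomb \<phi> P)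
      fix q :: "'m heis" assume q: "q \<in> heis_lattice j"
      have "?P q = (\<Sum>p\<in>F. if p = q then \<phi> q else 0)"
        using q \<psi>_same \<psi>_diff by (intro sum.cong) (auto simp: F_def)
      also have "\<dots> = \<phi> q" using F q K(2)[of q] by (auto simp: F_def)
      finally show "\<phi> q + (- 1) * ?P q = 0" by simp
    qed
    then have "M \<phi> = M ?P"
      using test_linearD[OF lin \<phi> P, of "- 1"] by simp
    also have "\<dots> = (\<Sum>p\<in>F. \<phi> p * \<alpha> p)"
      unfolding \<alpha>_def by (intro test_linear_sum[OF lin] F \<psi>)
    finally show ?thesis
      unfolding D2k[OF \<phi>] using K(2) by (intro has_sum_finite_neutralI[OF F])
        (auto simp: dirac_def F_def mult.commute)
  qed
  ultimately show ?thesis by blast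
qed

end
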